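(* The contravariant functors $\mathrm{at}$ and $\mathcal{P}$, which yield a dual equivalence between the category of locally compact Hausdorff MT-algebras with proper MT-morphisms and the category of locally compact Hausdorff spaces with proper maps, restrict to a dual equivalence between the category $\mathbf{KHMT}$ of compact Hausdorff MT-algebras and MT-morphisms and the category $\mathbf{KHaus}$ of compact Hausdorff spaces and continuous maps.
   Context: An MT-algebra is a pair $M=(B,\square)$ where $B$ is a complete boolean algebra and $\square:B\to B$ satisfies $\square 1=1$, $\square(a\wedge b)=\square a\wedge\square b$, $\square a\le a$, $\square a\le\square\square a$. An MT-morphism $f:M\to N$ is a complete boolean homomorphism with $f(\square_M a)\le\square_N f(a)$ for all $a$. Put $\diamond a=\neg\square\neg a$. An element $a$ is open if $a=\square a$; $\mathrm{O}(M)$ is the set of open elements. An element is saturated if it is a meet of open elements. $M$ is Hausdorff if every element of $M$ is a join of elements of $\mathrm{AC}(M)=\{a\in M\mid a=\bigwedge\{\diamond\square c\mid c\in M,\ a\le\square c\}\}$. An element $a$ is compact if for each $S\subseteq\mathrm{O}(M)$ with $a\le\bigvee S$ there is a finite $T\subseteq S$ with $a\le\bigvee T$; $M$ is compact if its top element is compact; $\mathrm{KS}(M)$ is the set of compact saturated elements. For $a,b\in M$ write $a\vartriangleleft b$ if there is a compact $k$ with $a\le k\le b$. $M$ is locally compact if $u=\bigvee\{v\in\mathrm{O}(M)\mid v\vartriangleleft u\}$ for all $u\in\mathrm{O}(M)$. An MT-morphism $f:M\to N$ is proper if $a\in\mathrm{KS}(M)$ implies $f(a)\in\mathrm{KS}(N)$.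 A continuous map $f:X\to Y$ is proper if $f^{-1}(K)$ is compact for each compact saturated $K\subseteq Y$ (saturated = intersection of open sets). Functors: $\mathcal{P}$ sends a space $X$ to $(\mathcal{P}(X),\mathrm{int})$ (the powerset with the interior operator) and a map $f$ to $f^{-1}$. $\mathrm{at}$ sends $M$ to its set of atoms $\mathrm{at}(M)$ with topology $\{\eta(a)\mid a\in\mathrm{O}(M)\}$, where $\eta(a)=\{x\in\mathrm{at}(M)\mid x\le a\}$, and an MT-morphism $f:M\to N$ to $\mathrm{at}(f):\mathrm{at}(N)\to\mathrm{at}(M)$, the restriction to atoms of the left adjoint $f^*(x)=\bigwedge\{a\in M\mid x\le f(a)\}$. *)

theory Defs
  imports "HOL-Analysis.Analysis" "HOL-Algebra.Complete_Lattice"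
begin

section \<open>MT-algebras\<close>

text \<open>Carrier-based, since the algebra of subsets of a space and the space of atoms of an algebra
  live on proper subsets of types. The type class of complete boolean algebras is not used: it
  requires complete distributivity, which forces atomicity.\<close>

record 'a mt = "'a gorder" +
  Box :: "'a \<Rightarrow> 'a"

definition boolean_lattice :: "('a, 'm) gorder_scheme \<Rightarrow> bool" where
  "boolean_lattice L \<longleftrightarrow> bounded_lattice L \<and>
     (\<forall>a \<in> carrier L. \<forall>b \<in> carrier L. \<forall>c \<in> carrier L.
        a \<sqinter>\<^bsub>L\<^esub> (b \<squnion>\<^bsub>L\<^esub> c) = (a \<sqinter>\<^bsub>L\<^esub> b) \<squnion>\<^bsub>L\<^esub> (a \<sqinter>\<^bsub>L\<^esub> c)) \<and>
     (\<forall>a \<in> carrier L. \<exists>c \<in> carrier L. a \<sqinter>\<^bsub>L\<^esub> c = \<bottom>\<^bsub>L\<^esub> \<and> a \<squnion>\<^bsub>L\<^esub> c = \<top>\<^bsub>L\<^esub>)"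

definition compl :: "('a, 'm) gorder_scheme \<Rightarrow> 'a \<Rightarrow> 'a" where
  "compl L a = (THE c. c \<in> carrier L \<and> a \<sqinter>\<^bsub>L\<^esub> c = \<bottom>\<^bsub>L\<^esub> \<and> a \<squnion>\<^bsub>L\<^esub> c = \<top>\<^bsub>L\<^esub>)"

definition mt_algebra :: "'a mt \<Rightarrow> bool" where
  "mt_algebra M \<longleftrightarrow> complete_lattice M \<and> boolean_lattice M \<and>
     Box M \<in> carrier M \<rightarrow> carrier M \<and>
     Box M \<top>\<^bsub>M\<^esub> = \<top>\<^bsub>M\<^esub> \<and>
     (\<forall>a \<in> carrier M. \<forall>b \<in> carrier M. Box M (a \<sqinter>\<^bsub>M\<^esub> b) = Box M a \<sqinter>\<^bsub>M\<^esub> Box M b) \<and>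
     (\<forall>a \<in> carrier M. Box M a \<sqsubseteq>\<^bsub>M\<^esub> a) \<and>
     (\<forall>a \<in> carrier M. Box M a \<sqsubseteq>\<^bsub>M\<^esub> Box M (Box M a))"

definition Diamond :: "'a mt \<Rightarrow> 'a \<Rightarrow> 'a" where
  "Diamond M a = compl M (Box M (compl M a))"

definition mt_opens :: "'a mt \<Rightarrow> 'a set" where
  "mt_opens M = {a \<in> carrier M. a = Box M a}"

definition mt_saturated :: "'a mt \<Rightarrow> 'a \<Rightarrow> bool" where
  "mt_saturated M a \<longleftrightarrow> (\<exists>S \<subseteq> mt_opens M. a = \<Sqinter>\<^bsub>M\<^esub>S)"

definition mt_AC :: "'a mt \<Rightarrow> 'a set" where
  "mt_AC M = {a \<in> carrier M.
     a = \<Sqinter>\<^bsub>M\<^esub>{Diamond M (Box M c) | c. c \<in> carrier M \<and> a \<sqsubseteq>\<^bsub>M\<^esub> Box M c}}"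

definition mt_Hausdorff :: "'a mt \<Rightarrow> bool" where
  "mt_Hausdorff M \<longleftrightarrow> (\<forall>a \<in> carrier M. \<exists>S \<subseteq> mt_AC M. a = \<Squnion>\<^bsub>M\<^esub>S)"

definition compact_element :: "'a mt \<Rightarrow> 'a \<Rightarrow> bool" where
  "compact_element M a \<longleftrightarrow> a \<in> carrier M \<and>
     (\<forall>S \<subseteq> mt_opens M. a \<sqsubseteq>\<^bsub>M\<^esub> \<Squnion>\<^bsub>M\<^esub>S \<longrightarrow> (\<exists>T \<subseteq> S. finite T \<and> a \<sqsubseteq>\<^bsub>M\<^esub> \<Squnion>\<^bsub>M\<^esub>T))"

definition mt_compact :: "'a mt \<Rightarrow> bool" where
  "mt_compact M \<longleftrightarrow> compact_element M \<top>\<^bsub>M\<^esub>"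

definition mt_KS :: "'a mt \<Rightarrow> 'a set" where
  "mt_KS M = {a \<in> carrier M. compact_element M a \<and> mt_saturated M a}"

definition mt_below :: "'a mt \<Rightarrow> 'a \<Rightarrow> 'a \<Rightarrow> bool" where
  "mt_below M a b \<longleftrightarrow> (\<exists>k. compact_element M k \<and> a \<sqsubseteq>\<^bsub>M\<^esub> k \<and> k \<sqsubseteq>\<^bsub>M\<^esub> b)"

definition mt_locally_compact :: "'a mt \<Rightarrow> bool" where
  "mt_locally_compact M \<longleftrightarrow>
     (\<forall>u \<in> mt_opens M. u = \<Squnion>\<^bsub>M\<^esub>{v \<in> mt_opens M. mt_below M v u})"

text \<open>Morphisms are extensional functions (undefined outside the carrier), so that equality of
  morphisms is equality of functions.\<close>

definition mt_hom :: "'a mt \<Rightarrow> 'b mt \<Rightarrow> ('a \<Rightarrow> 'b) set" where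
  "mt_hom M N = {f \<in> carrier M \<rightarrow>\<^sub>E carrier N.
     (\<forall>S \<subseteq> carrier M. f (\<Squnion>\<^bsub>M\<^esub>S) = \<Squnion>\<^bsub>N\<^esub>(f ` S)) \<and>
     (\<forall>S \<subseteq> carrier M. f (\<Sqinter>\<^bsub>M\<^esub>S) = \<Sqinter>\<^bsub>N\<^esub>(f ` S)) \<and>
     (\<forall>a \<in> carrier M. f (compl M a) = compl N (f a)) \<and>
     (\<forall>a \<in> carrier M. f (Box M a) \<sqsubseteq>\<^bsub>N\<^esub> Box N (f a))}"

definition proper_mt_hom :: "'a mt \<Rightarrow> 'b mt \<Rightarrow> ('a \<Rightarrow> 'b) set" where
  "proper_mt_hom M N = {f \<in> mt_hom M N. \<forall>a \<in> mt_KS M. f a \<in> mt_KS N}"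


section \<open>Spaces\<close>

definition saturatedin :: "'a topology \<Rightarrow> 'a set \<Rightarrow> bool" where
  "saturatedin X K \<longleftrightarrow> (\<exists>\<U>. (\<forall>U \<in> \<U>. openin X U) \<and> K = topspace X \<inter> \<Inter>\<U>)"

definition continuous_hom :: "'a topology \<Rightarrow> 'b topology \<Rightarrow> ('a \<Rightarrow> 'b) set" where
  "continuous_hom X Y = {f \<in> topspace X \<rightarrow>\<^sub>E topspace Y. continuous_map X Y f}"

text \<open>The library's \<open>proper_map\<close> (closed with compact fibres) is a different notion.\<close>

definition proper_hom :: "'a topology \<Rightarrow> 'b topology \<Rightarrow> ('a \<Rightarrow> 'b) set" where
  "proper_hom X Y = {f \<in> continuous_hom X Y.
     \<forall>K. compactin Y K \<and> saturatedin Y K \<longrightarrow> compactin X {x \<in> topspace X. f x \<in> K}}"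


section \<open>Categories of structured sets\<close>

text \<open>All four categories below have objects with an underlying set and certain extensional
  functions between underlying sets as morphisms; composition is composition of functions
  (\<^const>\<open>compose\<close>) and identities are the (restricted) identity functions.\<close>

record ('o, 'a) concrete_category =
  Ob :: "'o set"
  Pt :: "'o \<Rightarrow> 'a set"
  Hom :: "'o \<Rightarrow> 'o \<Rightarrow> ('a \<Rightarrow> 'a) set"

definition Idn :: "('o, 'a) concrete_category \<Rightarrow> 'o \<Rightarrow> 'a \<Rightarrow> 'a" where
  "Idn C X = (\<lambda>x \<in> Pt C X. x)"

text \<open>The unit and associativity laws hold automatically for extensional functions.\<close>

definition is_category :: "('o, 'a) concrete_category \<Rightarrow> bool" where
  "is_category C \<longleftrightarrow>
     (\<forall>X \<in> Ob C. \<forall>Y \<in> Ob C. Hom C X Y \<subseteq> Pt C X \<rightarrow>\<^sub>E Pt C Y) \<and>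
     (\<forall>X \<in> Ob C. Idn C X \<in> Hom C X X) \<and>
     (\<forall>X \<in> Ob C. \<forall>Y \<in> Ob C. \<forall>Z \<in> Ob C. \<forall>f \<in> Hom C X Y. \<forall>g \<in> Hom C Y Z.
        compose (Pt C X) g f \<in> Hom C X Z)"

definition full_subcategory ::
  "('o, 'a) concrete_category \<Rightarrow> ('o, 'a) concrete_category \<Rightarrow> bool" where
  "full_subcategory C D \<longleftrightarrow> Ob C \<subseteq> Ob D \<and> (\<forall>X \<in> Ob C. Pt C X = Pt D X) \<and>
     (\<forall>X \<in> Ob C. \<forall>Y \<in> Ob C. Hom C X Y = Hom D X Y)"

text \<open>\<open>on_hom F X Y f\<close> is the value of \<open>F\<close> at a morphism \<open>f\<close> from \<open>X\<close> to \<open>Y\<close>.\<close>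

record ('o, 'a, 'p, 'b) functor_data =
  on_ob :: "'o \<Rightarrow> 'p"
  on_hom :: "'o \<Rightarrow> 'o \<Rightarrow> ('a \<Rightarrow> 'a) \<Rightarrow> ('b \<Rightarrow> 'b)"

definition contravariant_functor ::
  "('o, 'a) concrete_category \<Rightarrow> ('p, 'b) concrete_category \<Rightarrow> ('o, 'a, 'p, 'b) functor_data \<Rightarrow> bool"
where
  "contravariant_functor C D F \<longleftrightarrow>
     (\<forall>X \<in> Ob C. on_ob F X \<in> Ob D) \<and>
     (\<forall>X \<in> Ob C. \<forall>Y \<in> Ob C. \<forall>f \<in> Hom C X Y.
        on_hom F X Y f \<in> Hom D (on_ob F Y) (on_ob F X)) \<and>
     (\<forall>X \<in> Ob C. on_hom F X X (Idn C X) = Idn D (on_ob F X)) \<and>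
     (\<forall>X \<in> Ob C. \<forall>Y \<in> Ob C. \<forall>Z \<in> Ob C. \<forall>f \<in> Hom C X Y. \<forall>g \<in> Hom C Y Z.
        on_hom F X Z (compose (Pt C X) g f) =
        compose (Pt D (on_ob F Z)) (on_hom F X Y f) (on_hom F Y Z g))"

definition id_functor :: "('o, 'a, 'o, 'a) functor_data" where
  "id_functor = \<lparr>on_ob = (\<lambda>X. X), on_hom = (\<lambda>X Y f. f)\<rparr>"

text \<open>The composite of two contravariant functors, \<open>F\<close> first.\<close>

definition contra_comp ::
  "('p, 'b, 'q, 'c) functor_data \<Rightarrow> ('o, 'a, 'p, 'b) functor_data \<Rightarrow> ('o, 'a, 'q, 'c) functor_data"
where
  "contra_comp G F = \<lparr>on_ob = (\<lambda>X. on_ob G (on_ob F X)),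
     on_hom = (\<lambda>X Y f. on_hom G (on_ob F Y) (on_ob F X) (on_hom F X Y f))\<rparr>"

text \<open>Powersets raise the element type: a space over \<open>'a\<close> must be compared with one over
  \<open>'a set\<close>. Hence the covariant functors \<open>F\<close> and \<open>G\<close> from \<open>C\<close> take values in
  \<open>D\<close> and \<open>E\<close>, which are to be the same category at two element types; \<open>H\<close> and \<open>H'\<close>
  are the hom-sets of that category from \<open>D\<close>-objects to \<open>E\<close>-objects and back.\<close>

definition naturally_isomorphic ::
  "('o, 'a) concrete_category \<Rightarrow>
   ('p, 'b) concrete_category \<Rightarrow> ('o, 'a, 'p, 'b) functor_data \<Rightarrow>
   ('q, 'c) concrete_category \<Rightarrow> ('o, 'a, 'q, 'c) functor_data \<Rightarrow>
   ('p \<Rightarrow> 'q \<Rightarrow> ('b \<Rightarrow> 'c) set) \<Rightarrow> ('q \<Rightarrow> 'p \<Rightarrow> ('c \<Rightarrow> 'b) set) \<Rightarrow> bool"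
where
  "naturally_isomorphic C D F E G H H' \<longleftrightarrow> (\<exists>\<tau>.
     (\<forall>X \<in> Ob C. \<tau> X \<in> H (on_ob F X) (on_ob G X) \<and>
        (\<exists>\<sigma> \<in> H' (on_ob G X) (on_ob F X).
           compose (Pt D (on_ob F X)) \<sigma> (\<tau> X) = Idn D (on_ob F X) \<and>
           compose (Pt E (on_ob G X)) (\<tau> X) \<sigma> = Idn E (on_ob G X))) \<and>
     (\<forall>X \<in> Ob C. \<forall>Y \<in> Ob C. \<forall>f \<in> Hom C X Y.
        compose (Pt D (on_ob F X)) (\<tau> Y) (on_hom F X Y f) =
        compose (Pt D (on_ob F X)) (on_hom G X Y f) (\<tau> X)))"

definition LKHMT :: "('a mt, 'a) concrete_category" where
  "LKHMT = \<lparr>Ob = {M. mt_algebra M \<and> mt_locally_compact M \<and> mt_Hausdorff M},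
            Pt = carrier, Hom = proper_mt_hom\<rparr>"

definition KHMT :: "('a mt, 'a) concrete_category" where
  "KHMT = \<lparr>Ob = {M. mt_algebra M \<and> mt_compact M \<and> mt_Hausdorff M},
           Pt = carrier, Hom = mt_hom\<rparr>"

definition LKHaus :: "('a topology, 'a) concrete_category" where
  "LKHaus = \<lparr>Ob = {X. locally_compact_space X \<and> Hausdorff_space X},
             Pt = topspace, Hom = proper_hom\<rparr>"

definition KHaus :: "('a topology, 'a) concrete_category" where
  "KHaus = \<lparr>Ob = {X. compact_space X \<and> Hausdorff_space X},
            Pt = topspace, Hom = continuous_hom\<rparr>"


section \<open>The two functors\<close>

definition powerset_mt :: "'a topology \<Rightarrow> 'a set mt" where
  "powerset_mt X = \<lparr>carrier = Pow (topspace X), eq = (=), le = (\<subseteq>),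
                    Box = (\<lambda>A. X interior_of A)\<rparr>"

definition powerset_functor :: "('a topology, 'a, 'a set mt, 'a set) functor_data" where
  "powerset_functor = \<lparr>on_ob = powerset_mt,
     on_hom = (\<lambda>X Y f. \<lambda>B \<in> Pow (topspace Y). {x \<in> topspace X. f x \<in> B})\<rparr>"

definition atoms :: "'a mt \<Rightarrow> 'a set" where
  "atoms M = {x \<in> carrier M. x \<noteq> \<bottom>\<^bsub>M\<^esub> \<and>
     (\<forall>a \<in> carrier M. a \<sqsubseteq>\<^bsub>M\<^esub> x \<longrightarrow> a = \<bottom>\<^bsub>M\<^esub> \<or> a = x)}"

definition eta :: "'a mt \<Rightarrow> 'a \<Rightarrow> 'a set" where
  "eta M a = {x \<in> atoms M. x \<sqsubseteq>\<^bsub>M\<^esub> a}"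

definition at_space :: "'a mt \<Rightarrow> 'a topology" where
  "at_space M = topology (\<lambda>U. \<exists>a \<in> mt_opens M. U = eta M a)"

definition left_adj :: "'a mt \<Rightarrow> 'b mt \<Rightarrow> ('a \<Rightarrow> 'b) \<Rightarrow> 'b \<Rightarrow> 'a" where
  "left_adj M N f x = \<Sqinter>\<^bsub>M\<^esub>{a \<in> carrier M. x \<sqsubseteq>\<^bsub>N\<^esub> f a}"

definition at_functor :: "('a mt, 'a, 'a topology, 'a) functor_data" where
  "at_functor = \<lparr>on_ob = at_space,
     on_hom = (\<lambda>M N f. \<lambda>x \<in> atoms N. left_adj M N f x)\<rparr>"

end

theory Submission
  imports Defs
begin

text \<open>The crux is atomicity. Elements of \<open>AC(M)\<close> are closed, so in a Hausdorff MT-algebra the closed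
  elements are join-dense. If moreover the top is a join of compact elements, then every nonzero
  element lies above a nonzero closed compact one; Zorn's lemma, applied to the nonzero closed
  elements below it, gives a minimal one, which by join-density is an atom. Hence \<open>\<eta>\<close> is an
  isomorphism from \<open>M\<close> onto the powerset algebra of its space of atoms, and every property in question
  can be read off on that space. Between compact Hausdorff objects all morphisms are proper, so
  the compact case is the restriction to full subcategories.\<close>

section \<open>Boolean algebra and atoms of an MT-algebra\<close>

text \<open>Zorn's lemma cannot be run on all nonzero elements: a descending chain of them may have
  meet zero. Among closed elements below a compact one, the finite intersection property excludes
  this. Hausdorffness then enters twice: it supplies a member of this family, and it shows that a
  minimal member has nothing nonzero strictly below it in the whole algebra, where arbitrary
  elements must be compared with closed ones. The only distributive law at hand is the binary one.
  Infinite joins are therefore treated by complementation: \<open>b\<close> is disjoint from every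
  member of \<open>S\<close> exactly when \<open>compl M b\<close> is an upper bound of
  \<open>S\<close>. On morphisms, preservation of meets makes \<open>left_adj\<close> adjoint to
  \<open>f\<close>, and preservation of bottom and complements makes it send atoms to atoms. The
  adjunction says that \<open>eta N (f a)\<close> is the preimage of \<open>eta M a\<close>;
  continuity, properness and naturality are all read off from this identity.\<close>

locale mt = complete_lattice M for M :: "'a mt" (structure) +
  assumes mt_algebra: "mt_algebra M"

text \<open>The lattice assumption built into the locale is itself a conjunct of
  \<open>mt_algebra\<close>; interpretations go through this equivalence.\<close>

lemma mt_iff: "mt M \<longleftrightarrow> mt_algebra M"
  by (auto simp: mt_def mt_axioms_def mt_algebra_def)

context mt
begin

lemma Sup_empty [simp]: "\<Squnion>{} = \<bottom>"
  using weak_sup_empty by (simp add: eq_is_equal)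

lemma Inf_empty [simp]: "\<Sqinter>{} = \<top>"
  using weak_inf_empty by (simp add: eq_is_equal)

section \<open>Distributivity and complements\<close>

lemma meet_distrib_join:
  "\<lbrakk>a \<in> carrier M; b \<in> carrier M; c \<in> carrier M\<rbrakk> \<Longrightarrow> a \<sqinter> (b \<squnion> c) = (a \<sqinter> b) \<squnion> (a \<sqinter> c)"
  using mt_algebra by (simp add: mt_algebra_def boolean_lattice_def)

lemma join_bot [simp]: "a \<in> carrier M \<Longrightarrow> a \<squnion> \<bottom> = a"
  using le_iff_meet[of \<bottom> a] by (simp add: join_comm)

lemma bot_join [simp]: "a \<in> carrier M \<Longrightarrow> \<bottom> \<squnion> a = a"
  by (metis join_bot join_comm)

lemma meet_top [simp]: "a \<in> carrier M \<Longrightarrow> a \<sqinter> \<top> = a"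
  using le_iff_join[of a \<top>] by simp

lemma le_bot_iff: "a \<in> carrier M \<Longrightarrow> a \<sqsubseteq> \<bottom> \<longleftrightarrow> a = \<bottom>"
  using le_antisym[of a \<bottom>] by auto

text \<open>Expanding each complement against the join of \<open>a\<close> with the other shows that
  both equal their meet. As \<open>compl\<close> is a definite description, this has to precede
  every use of it.\<close>

lemma complement_unique:
  assumes "a \<in> carrier M" "c \<in> carrier M" "d \<in> carrier M"
    "a \<sqinter> c = \<bottom>" "a \<squnion> c = \<top>" "a \<sqinter> d = \<bottom>" "a \<squnion> d = \<top>"
  shows "c = d"
proof -
  have "c = c \<sqinter> (a \<squnion> d)" using assms by simp
  also have "\<dots> = (c \<sqinter> a) \<squnion> (c \<sqinter> d)" using assms by (intro meet_distrib_join)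
  also have "\<dots> = c \<sqinter> d" using assms by (simp add: meet_comm[of _ c a])
  finally have 1: "c = c \<sqinter> d" .
  have "d = d \<sqinter> (a \<squnion> c)" using assms by simp
  also have "\<dots> = (d \<sqinter> a) \<squnion> (d \<sqinter> c)" using assms by (intro meet_distrib_join)
  also have "\<dots> = d \<sqinter> c" using assms by (simp add: meet_comm[of _ d a])
  finally show ?thesis using 1 by (simp add: meet_comm[of _ d c])
qed

lemma compl_props:
  assumes "a \<in> carrier M"
  shows "compl M a \<in> carrier M \<and> a \<sqinter> compl M a = \<bottom> \<and> a \<squnion> compl M a = \<top>"
proof -
  obtain c where "c \<in> carrier M" "a \<sqinter> c = \<bottom>" "a \<squnion> c = \<top>"
    using mt_algebra assms unfolding mt_algebra_def boolean_lattice_def by blast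
  then have "\<exists>!c. c \<in> carrier M \<and> a \<sqinter> c = \<bottom> \<and> a \<squnion> c = \<top>"
    using complement_unique assms by blast
  then show ?thesis unfolding compl_def by (rule theI')
qed

lemma compl_closed [simp]: "a \<in> carrier M \<Longrightarrow> compl M a \<in> carrier M"
  and meet_compl [simp]: "a \<in> carrier M \<Longrightarrow> a \<sqinter> compl M a = \<bottom>"
  and join_compl [simp]: "a \<in> carrier M \<Longrightarrow> a \<squnion> compl M a = \<top>"
  using compl_props by blast+

lemma compl_eqI:
  "\<lbrakk>a \<in> carrier M; c \<in> carrier M; a \<sqinter> c = \<bottom>; a \<squnion> c = \<top>\<rbrakk> \<Longrightarrow> compl M a = c"
  using complement_unique by (metis compl_props)

lemma compl_compl [simp]: "a \<in> carrier M \<Longrightarrow> compl M (compl M a) = a"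
  by (rule compl_eqI) (auto simp: meet_comm[of _ _ a] join_comm[of _ _ a])

text \<open>Turns disjointness into an order relation, so that disjointness from a join of
  arbitrarily many elements can be proved by \<open>sup_least\<close>.\<close>

lemma le_compl_iff:
  assumes "a \<in> carrier M" "b \<in> carrier M"
  shows "a \<sqsubseteq> compl M b \<longleftrightarrow> a \<sqinter> b = \<bottom>"
proof
  assume "a \<sqsubseteq> compl M b"
  then have "a \<sqinter> b \<sqsubseteq> b \<sqinter> compl M b"
    using assms by (meson meet_le meet_left meet_right le_trans meet_closed compl_closed)
  then show "a \<sqinter> b = \<bottom>" using assms by (simp add: le_bot_iff)
next
  assume *: "a \<sqinter> b = \<bottom>"
  have "a = a \<sqinter> (b \<squnion> compl M b)" using assms by simp
  also have "\<dots> = (a \<sqinter> b) \<squnion> (a \<sqinter> compl M b)"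
    using assms by (intro meet_distrib_join) auto
  also have "\<dots> = a \<sqinter> compl M b" using * assms by simp
  finally show "a \<sqsubseteq> compl M b" using assms by (metis meet_right compl_closed)
qed

lemma le_compl_sym:
  "\<lbrakk>a \<in> carrier M; b \<in> carrier M\<rbrakk> \<Longrightarrow> a \<sqsubseteq> compl M b \<longleftrightarrow> b \<sqsubseteq> compl M a"
  by (simp add: le_compl_iff meet_comm)

lemma compl_le_sym:
  "\<lbrakk>a \<in> carrier M; b \<in> carrier M\<rbrakk> \<Longrightarrow> compl M a \<sqsubseteq> b \<longleftrightarrow> compl M b \<sqsubseteq> a"
  using le_compl_sym[of "compl M a" "compl M b"] by simp

lemma le_compl_self: "\<lbrakk>a \<in> carrier M; a \<sqsubseteq> compl M a\<rbrakk> \<Longrightarrow> a = \<bottom>"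
  by (metis le_compl_iff meet_compl le_iff_join compl_closed)

lemma compl_bot [simp]: "compl M \<bottom> = \<top>"
  by (rule compl_eqI) auto

text \<open>Infinite De Morgan law: complementation is an order-reversing involution, so it
  exchanges lower bounds of \<open>S\<close> with upper bounds of the complements.\<close>

lemma compl_Inf:
  assumes S: "S \<subseteq> carrier M"
  shows "compl M (\<Sqinter>S) = \<Squnion>(compl M ` S)"
proof (rule le_antisym)
  have cS: "compl M ` S \<subseteq> carrier M" using S by auto
  have "compl M (\<Squnion>(compl M ` S)) \<sqsubseteq> \<Sqinter>S"
  proof (rule inf_greatest[OF S])
    fix s assume "s \<in> S"
    then show "compl M (\<Squnion>(compl M ` S)) \<sqsubseteq> s"
      using S cS compl_le_sym[of "\<Squnion>(compl M ` S)" s] by (auto intro!: sup_upper)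
  qed (use cS in auto)
  then show "compl M (\<Sqinter>S) \<sqsubseteq> \<Squnion>(compl M ` S)"
    using compl_le_sym[of "\<Sqinter>S" "\<Squnion>(compl M ` S)"] S cS by auto
  show "\<Squnion>(compl M ` S) \<sqsubseteq> compl M (\<Sqinter>S)"
  proof (rule sup_least[OF cS])
    fix y assume "y \<in> compl M ` S"
    then obtain s where s: "s \<in> S" "y = compl M s" by auto
    then show "y \<sqsubseteq> compl M (\<Sqinter>S)"
      using S le_compl_sym[of "compl M s" "\<Sqinter>S"] inf_lower[OF S s(1)] by auto
  qed (use S in auto)
qed (use S in \<open>auto intro!: sup_closed\<close>)

lemma Sup_mono: "\<lbrakk>S \<subseteq> T; T \<subseteq> carrier M\<rbrakk> \<Longrightarrow> \<Squnion>S \<sqsubseteq> \<Squnion>T"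
  by (rule sup_least) (auto intro: sup_upper)

lemma le_of_le_join_compl:
  assumes "a \<in> carrier M" "b \<in> carrier M" "a \<sqsubseteq> b \<squnion> compl M a"
  shows "a \<sqsubseteq> b"
proof -
  have "a = a \<sqinter> (b \<squnion> compl M a)" using assms le_iff_join[of a] by simp
  also have "\<dots> = (a \<sqinter> b) \<squnion> (a \<sqinter> compl M a)"
    using assms by (intro meet_distrib_join) auto
  also have "\<dots> = a \<sqinter> b" using assms by simp
  finally show ?thesis using assms by (metis meet_right)
qed

section \<open>The interior operator and the open elements\<close>

lemma Box_closed [simp]: "a \<in> carrier M \<Longrightarrow> Box M a \<in> carrier M"
  and Box_le: "a \<in> carrier M \<Longrightarrow> Box M a \<sqsubseteq> a"
  and Box_meet: "\<lbrakk>a \<in> carrier M; b \<in> carrier M\<rbrakk> \<Longrightarrow> Box M (a \<sqinter> b) = Box M a \<sqinter> Box M b"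
  and Box_top: "Box M \<top> = \<top>"
  using mt_algebra by (auto simp: mt_algebra_def)

lemma Box_Box [simp]: "a \<in> carrier M \<Longrightarrow> Box M (Box M a) = Box M a"
  using mt_algebra by (intro le_antisym Box_le) (auto simp: mt_algebra_def)

lemma Box_mono: "\<lbrakk>a \<in> carrier M; b \<in> carrier M; a \<sqsubseteq> b\<rbrakk> \<Longrightarrow> Box M a \<sqsubseteq> Box M b"
  by (metis Box_meet Box_closed le_iff_join)

lemma opens_carrier: "mt_opens M \<subseteq> carrier M"
  by (auto simp: mt_opens_def)

lemma opens_closed: "u \<in> mt_opens M \<Longrightarrow> u \<in> carrier M"
  using opens_carrier by auto

lemma Box_opens: "a \<in> carrier M \<Longrightarrow> Box M a \<in> mt_opens M"
  by (simp add: mt_opens_def)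

lemma opensI: "\<lbrakk>a \<in> carrier M; a \<sqsubseteq> Box M a\<rbrakk> \<Longrightarrow> a \<in> mt_opens M"
  unfolding mt_opens_def using Box_le le_antisym by auto

lemma open_le_Box:
  "\<lbrakk>u \<in> mt_opens M; a \<in> carrier M\<rbrakk> \<Longrightarrow> u \<sqsubseteq> Box M a \<longleftrightarrow> u \<sqsubseteq> a"
  using le_trans[OF _ Box_le, of u a] Box_mono[of u a] by (auto simp: mt_opens_def)

lemma opens_meet: "\<lbrakk>u \<in> mt_opens M; v \<in> mt_opens M\<rbrakk> \<Longrightarrow> u \<sqinter> v \<in> mt_opens M"
  by (auto simp: mt_opens_def Box_meet)

lemma opens_Sup:
  assumes "S \<subseteq> mt_opens M"
  shows "\<Squnion>S \<in> mt_opens M"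
proof (rule opensI)
  have S: "S \<subseteq> carrier M" using assms opens_carrier by blast
  then show "\<Squnion>S \<in> carrier M" by simp
  show "\<Squnion>S \<sqsubseteq> Box M (\<Squnion>S)"
  proof (rule sup_least)
    fix u assume "u \<in> S"
    then show "u \<sqsubseteq> Box M (\<Squnion>S)" using S assms by (subst open_le_Box) (auto intro: sup_upper)
  qed (use S in auto)
qed

lemma opens_top: "\<top> \<in> mt_opens M"
  by (simp add: mt_opens_def Box_top)

section \<open>Atoms and the map \<open>eta\<close>\<close>

lemma atoms_closed: "x \<in> atoms M \<Longrightarrow> x \<in> carrier M"
  and atoms_not_bot: "x \<in> atoms M \<Longrightarrow> x \<noteq> \<bottom>"
  and atoms_minimal: "\<lbrakk>x \<in> atoms M; a \<in> carrier M; a \<sqsubseteq> x; a \<noteq> \<bottom>\<rbrakk> \<Longrightarrow> a = x"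
  by (auto simp: atoms_def)

lemma atoms_carrier: "atoms M \<subseteq> carrier M"
  using atoms_closed by auto

text \<open>The meet of an atom \<open>x\<close> with \<open>a\<close> lies below \<open>x\<close>,
  so it is bottom or \<open>x\<close>; these two cases decide the two sides.\<close>

lemma atom_le_compl_iff:
  assumes "x \<in> atoms M" "a \<in> carrier M"
  shows "x \<sqsubseteq> compl M a \<longleftrightarrow> \<not> x \<sqsubseteq> a"
proof -
  have x: "x \<in> carrier M" using assms atoms_closed by blast
  have "x \<sqinter> a = \<bottom> \<or> x \<sqinter> a = x"
    using assms x by (metis atoms_minimal meet_left meet_closed)
  moreover have "x \<sqinter> a = x \<longleftrightarrow> x \<sqsubseteq> a" using x assms le_iff_join[of x a] by auto
  ultimately show ?thesis using x assms le_compl_iff[of x a] atoms_not_bot[of x] by auto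
qed

text \<open>If \<open>x\<close> is below no member of \<open>S\<close>, then
  \<open>compl M x\<close> bounds \<open>S\<close>, and \<open>x\<close> would lie below its own
  complement. Complete join-primeness makes \<open>eta\<close> preserve arbitrary joins in every
  MT-algebra, atomic or not.\<close>

lemma atom_le_Sup_iff:
  assumes "x \<in> atoms M" "S \<subseteq> carrier M"
  shows "x \<sqsubseteq> \<Squnion>S \<longleftrightarrow> (\<exists>s\<in>S. x \<sqsubseteq> s)"
proof
  have x: "x \<in> carrier M" using assms atoms_closed by blast
  show "\<exists>s\<in>S. x \<sqsubseteq> s" if "x \<sqsubseteq> \<Squnion>S"
  proof (rule ccontr)
    assume *: "\<not> (\<exists>s\<in>S. x \<sqsubseteq> s)"
    have "\<Squnion>S \<sqsubseteq> compl M x"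
    proof (rule sup_least)
      fix s assume s: "s \<in> S"
      then have "x \<sqsubseteq> compl M s" using * assms by (auto simp: atom_le_compl_iff)
      then show "s \<sqsubseteq> compl M x" using le_compl_sym[of x s] s x assms by auto
    qed (use x assms in auto)
    then have "x \<sqsubseteq> compl M x" using that x assms by (meson le_trans compl_closed sup_closed)
    then show False using le_compl_self x atoms_not_bot assms by blast
  qed
  show "x \<sqsubseteq> \<Squnion>S" if "\<exists>s\<in>S. x \<sqsubseteq> s"
    using that assms x by (meson le_trans sup_upper subsetD sup_closed)
qed

lemma atom_le_Inf_iff:
  assumes "x \<in> atoms M" "S \<subseteq> carrier M"
  shows "x \<sqsubseteq> \<Sqinter>S \<longleftrightarrow> (\<forall>s\<in>S. x \<sqsubseteq> s)"
  using assms atoms_closed by (meson inf_greatest inf_lower le_trans subsetD inf_closed)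

lemma eta_subset: "eta M a \<subseteq> atoms M"
  by (auto simp: eta_def)

lemma eta_Sup: "S \<subseteq> carrier M \<Longrightarrow> eta M (\<Squnion>S) = (\<Union>s\<in>S. eta M s)"
  by (auto simp: eta_def atom_le_Sup_iff)

lemma eta_Inf: "S \<subseteq> carrier M \<Longrightarrow> eta M (\<Sqinter>S) = atoms M \<inter> (\<Inter>s\<in>S. eta M s)"
  by (auto simp: eta_def atom_le_Inf_iff)

lemma eta_compl: "a \<in> carrier M \<Longrightarrow> eta M (compl M a) = atoms M - eta M a"
  by (auto simp: eta_def atom_le_compl_iff)

lemma eta_meet: "\<lbrakk>a \<in> carrier M; b \<in> carrier M\<rbrakk> \<Longrightarrow> eta M (a \<sqinter> b) = eta M a \<inter> eta M b"
  using eta_Inf[of "{a, b}"] eta_subset by (auto simp: meet_def)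

lemma eta_top: "eta M \<top> = atoms M"
  using eta_Inf[of "{}"] by simp

lemma eta_mono: "\<lbrakk>a \<in> carrier M; b \<in> carrier M; a \<sqsubseteq> b\<rbrakk> \<Longrightarrow> eta M a \<subseteq> eta M b"
  using atoms_closed by (auto simp: eta_def intro: le_trans)

lemma eta_atom: "x \<in> atoms M \<Longrightarrow> eta M x = {x}"
  using atoms_closed atoms_minimal atoms_not_bot by (auto simp: eta_def)

text \<open>An atom below the join of \<open>A\<close> is below a member of \<open>A\<close>, hence
  equal to it. So \<open>eta\<close> is always onto the powerset of the atoms; atomicity will only
  contribute injectivity.\<close>

lemma eta_Sup_atoms:
  assumes "A \<subseteq> atoms M"
  shows "eta M (\<Squnion>A) = A"
proof -
  have "eta M (\<Squnion>A) = (\<Union>x\<in>A. eta M x)" using assms atoms_carrier by (intro eta_Sup) auto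
  also have "\<dots> = (\<Union>x\<in>A. {x})" using assms by (intro SUP_cong) (auto simp: eta_atom)
  finally show ?thesis by simp
qed

section \<open>The topology on the set of atoms\<close>

lemma openin_at_space: "openin (at_space M) U \<longleftrightarrow> (\<exists>a\<in>mt_opens M. U = eta M a)"
proof -
  have "istopology (\<lambda>U. \<exists>a\<in>mt_opens M. U = eta M a)"
    unfolding istopology_def
  proof (intro conjI allI impI)
    fix S T assume "\<exists>a\<in>mt_opens M. S = eta M a" "\<exists>a\<in>mt_opens M. T = eta M a"
    then show "\<exists>a\<in>mt_opens M. S \<inter> T = eta M a"
      by (metis eta_meet opens_meet opens_closed)
  next
    fix \<K> assume *: "\<forall>K\<in>\<K>. \<exists>a\<in>mt_opens M. K = eta M a"
    \<comment> \<open>Since \<open>eta\<close> need not be injective here, all open representatives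
      are collected at once; no choice of one per member of the family is made.\<close>
    define S where "S = {a \<in> mt_opens M. eta M a \<in> \<K>}"
    have S: "S \<subseteq> mt_opens M" by (auto simp: S_def)
    have "\<Union>\<K> = (\<Union>s\<in>S. eta M s)" using * unfolding S_def by auto
    then have "\<Union>\<K> = eta M (\<Squnion>S)" using S opens_carrier by (auto simp: eta_Sup)
    then show "\<exists>a\<in>mt_opens M. \<Union>\<K> = eta M a" using opens_Sup[OF S] by blast
  qed
  then show ?thesis unfolding at_space_def by (simp add: topology_inverse')
qed

lemma topspace_at_space: "topspace (at_space M) = atoms M"
proof
  show "topspace (at_space M) \<subseteq> atoms M"
    using openin_at_space[of "topspace (at_space M)"] eta_subset by auto
  show "atoms M \<subseteq> topspace (at_space M)"
    using openin_at_space[of "atoms M"] eta_top opens_top openin_subset by metis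
qed

end

section \<open>Atomicity and the space of atoms\<close>

context mt
begin

lemma compl_Diamond_Box:
  "c \<in> carrier M \<Longrightarrow> compl M (Diamond M (Box M c)) = Box M (compl M (Box M c))"
  by (simp add: Diamond_def)

lemma Diamond_closed [simp]: "a \<in> carrier M \<Longrightarrow> Diamond M a \<in> carrier M"
  by (simp add: Diamond_def)

text \<open>Each \<open>Diamond M (Box M c)\<close> is the complement of the open element
  \<open>Box M (compl M (Box M c))\<close>, so De Morgan turns the meet defining
  \<open>mt_AC\<close> into a join of opens.\<close>

lemma compl_AC_open:
  assumes "a \<in> mt_AC M"
  shows "compl M a \<in> mt_opens M"
proof -
  let ?D = "{Diamond M (Box M c) | c. c \<in> carrier M \<and> a \<sqsubseteq> Box M c}"
  have D: "?D \<subseteq> carrier M" by auto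
  have "a = \<Sqinter>?D" using assms by (simp add: mt_AC_def)
  then have "compl M a = \<Squnion>(compl M ` ?D)" using compl_Inf[OF D] by simp
  moreover have "compl M ` ?D \<subseteq> mt_opens M" by (auto simp: compl_Diamond_Box Box_opens)
  ultimately show ?thesis using opens_Sup by simp
qed

text \<open>A join of bottoms is bottom. This density statement is the form in which Hausdorffness
  is consumed, both for atomicity and in \<open>Hausdorff_at_space\<close>.\<close>

lemma Hausdorff_AC_below:
  assumes "mt_Hausdorff M" "b \<in> carrier M" "b \<noteq> \<bottom>"
  obtains c where "c \<in> mt_AC M" "c \<sqsubseteq> b" "c \<noteq> \<bottom>"
proof -
  obtain S where S: "S \<subseteq> mt_AC M" "b = \<Squnion>S"
    using assms unfolding mt_Hausdorff_def by blast
  have SM: "S \<subseteq> carrier M" using S by (auto simp: mt_AC_def)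
  have "\<exists>c\<in>S. c \<noteq> \<bottom>"
  proof (rule ccontr)
    assume "\<not> ?thesis"
    then have "\<Squnion>S \<sqsubseteq> \<bottom>" using SM by (intro sup_least) auto
    then have "b \<sqsubseteq> \<bottom>" using S by simp
    then show False using assms by (simp add: le_bot_iff)
  qed
  then show ?thesis using that S SM sup_upper by blast
qed

lemma compact_elementD:
  assumes "compact_element M k" "S \<subseteq> mt_opens M" "k \<sqsubseteq> \<Squnion>S"
  obtains T where "T \<subseteq> S" "finite T" "k \<sqsubseteq> \<Squnion>T"
  using assms unfolding compact_element_def by blast

lemma compact_element_closed: "compact_element M k \<Longrightarrow> k \<in> carrier M"
  by (simp add: compact_element_def)

text \<open>As for closed subsets of compact sets: adjoining the open \<open>compl M c\<close> to a
  cover of \<open>c\<close> gives a cover of \<open>k\<close>; from a finite subcover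
  \<open>compl M c\<close> may be deleted, because it is disjoint from \<open>c\<close>.\<close>

lemma closed_below_compact:
  assumes c: "c \<in> carrier M" "compl M c \<in> mt_opens M"
    and k: "compact_element M k" and ck: "c \<sqsubseteq> k"
  shows "compact_element M c"
  unfolding compact_element_def
proof (intro conjI allI impI)
  fix S assume S: "S \<subseteq> mt_opens M" and cS: "c \<sqsubseteq> \<Squnion>S"
  have SM: "S \<subseteq> carrier M" using S opens_carrier by blast
  have kM: "k \<in> carrier M" using k by (rule compact_element_closed)
  let ?S' = "insert (compl M c) S"
  have S': "?S' \<subseteq> carrier M" using SM c by auto
  have "c \<sqsubseteq> \<Squnion>?S'" "compl M c \<sqsubseteq> \<Squnion>?S'"
    using cS Sup_mono[of S ?S'] S' c SM by (meson le_trans subset_insertI sup_closed, blast intro: sup_upper)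
  then have "c \<squnion> compl M c \<sqsubseteq> \<Squnion>?S'" using c S' by (intro join_le) auto
  then have "\<Squnion>?S' = \<top>" using c S' by (auto intro: le_antisym)
  then have "k \<sqsubseteq> \<Squnion>?S'" using kM by simp
  then obtain T where T: "T \<subseteq> ?S'" "finite T" "k \<sqsubseteq> \<Squnion>T"
    using k S c by (metis compact_elementD insert_subset)
  \<comment> \<open>If \<open>compl M c\<close> happens to be a member of \<open>S\<close> as well,
    it is discarded too, which does no harm.\<close>
  define T' where "T' = T - {compl M c}"
  have TM: "T \<subseteq> carrier M" "T' \<subseteq> carrier M" using T S' by (auto simp: T'_def)
  have "\<Squnion>T \<sqsubseteq> \<Squnion>T' \<squnion> compl M c"
  proof (rule sup_least)
    fix t assume t: "t \<in> T"
    show "t \<sqsubseteq> \<Squnion>T' \<squnion> compl M c"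
    proof (cases "t = compl M c")
      case True
      then show ?thesis using TM c by (simp add: join_right)
    next
      case False
      then have "t \<sqsubseteq> \<Squnion>T'" using t TM by (auto simp: T'_def intro: sup_upper)
      then show ?thesis
        using t TM c by (meson join_left le_trans subsetD sup_closed join_closed compl_closed)
    qed
  qed (use TM c in auto)
  then have "c \<sqsubseteq> \<Squnion>T' \<squnion> compl M c"
    using ck T(3) c kM TM by (meson le_trans sup_closed join_closed compl_closed)
  then have "c \<sqsubseteq> \<Squnion>T'" using le_of_le_join_compl c TM by auto
  then show "\<exists>T\<subseteq>S. finite T \<and> c \<sqsubseteq> \<Squnion>T"
    using T by (intro exI[of _ T']) (auto simp: T'_def)
qed (use c in simp)

lemma chain_finite_lower_bound:
  assumes "finite F" "F \<noteq> {}" "F \<subseteq> C" "C \<subseteq> carrier M"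
    and chain: "\<And>x y. \<lbrakk>x \<in> C; y \<in> C\<rbrakk> \<Longrightarrow> x \<sqsubseteq> y \<or> y \<sqsubseteq> x"
  shows "\<exists>d\<in>F. \<forall>e\<in>F. d \<sqsubseteq> e"
  using assms(1-3)
proof (induction F rule: finite_ne_induct)
  case (singleton x)
  then show ?case using assms by auto
next
  case (insert x F)
  then obtain d where d: "d \<in> F" "\<forall>e\<in>F. d \<sqsubseteq> e" by auto
  have M: "x \<in> carrier M" "F \<subseteq> carrier M" "d \<in> carrier M"
    using insert d assms(4) by auto
  show ?case
  proof (cases "d \<sqsubseteq> x")
    case True
    then show ?thesis using d by auto
  next
    case False
    then have "x \<sqsubseteq> d" using chain[of d x] insert d by auto
    then have "\<forall>e\<in>insert x F. x \<sqsubseteq> e" using d M by (auto intro: le_trans[of x d])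
    then show ?thesis by auto
  qed
qed

text \<open>If the meet were bottom, the complements of the chain would cover \<open>k\<close>. A
  finite subcover comes from finitely many chain members; their least one, \<open>d\<close>, has the
  largest complement, so \<open>d\<close> would lie below \<open>k\<close> and hence below
  \<open>compl M d\<close>, forcing it to be bottom.\<close>

lemma closed_chain_Inf_not_bot:
  assumes k: "compact_element M k" "k \<noteq> \<bottom>"
    and C: "C \<subseteq> carrier M" "compl M ` C \<subseteq> mt_opens M"
    and Ck: "\<And>d. d \<in> C \<Longrightarrow> d \<sqsubseteq> k \<and> d \<noteq> \<bottom>"
    and chain: "\<And>x y. \<lbrakk>x \<in> C; y \<in> C\<rbrakk> \<Longrightarrow> x \<sqsubseteq> y \<or> y \<sqsubseteq> x"
  shows "\<Sqinter>C \<noteq> \<bottom>"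
proof
  assume "\<Sqinter>C = \<bottom>"
  have kM: "k \<in> carrier M" using k compact_element_closed by blast
  have "\<Squnion>(compl M ` C) = \<top>" using compl_Inf[OF C(1)] \<open>\<Sqinter>C = \<bottom>\<close> by simp
  then obtain T where T: "T \<subseteq> compl M ` C" "finite T" "k \<sqsubseteq> \<Squnion>T"
    using compact_elementD[OF k(1) C(2)] kM by auto
  then obtain F where F: "F \<subseteq> C" "finite F" "T = compl M ` F"
    by (meson finite_subset_image)
  \<comment> \<open>An empty subcover has join bottom, but \<open>k\<close> is nonzero.\<close>
  have "F \<noteq> {}" using F T k kM by (auto simp: le_bot_iff)
  then obtain d where d: "d \<in> F" "\<And>e. e \<in> F \<Longrightarrow> d \<sqsubseteq> e"
    using chain_finite_lower_bound[OF F(2) _ F(1) C(1)] chain by blast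
  have dM: "d \<in> carrier M" and FM: "F \<subseteq> carrier M" using d F C by auto
  have "\<Squnion>T \<sqsubseteq> compl M d"
  proof (rule sup_least)
    fix t assume "t \<in> T"
    then obtain e where "e \<in> F" "t = compl M e" using F by auto
    then show "t \<sqsubseteq> compl M d" using d FM dM compl_le_sym[of e "compl M d"] by auto
  qed (use F FM dM in auto)
  moreover have "d \<sqsubseteq> k" using Ck d F by blast
  moreover have "T \<subseteq> carrier M" using F FM by auto
  ultimately have "d \<sqsubseteq> compl M d"
    using T(3) dM kM by (meson le_trans sup_closed compl_closed)
  then show False using le_compl_self dM Ck d F by blast
qed

text \<open>The cover \<open>K\<close> is left abstract so that two cases share one argument:
  \<open>{\<top>}\<close> for compact algebras, and all compact elements for locally compact
  ones.\<close>

lemma atom_below: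
  assumes H: "mt_Hausdorff M"
    and cover: "K \<subseteq> Collect (compact_element M)" "\<Squnion>K = \<top>"
    and b: "b \<in> carrier M" "b \<noteq> \<bottom>"
  shows "\<exists>x\<in>atoms M. x \<sqsubseteq> b"
proof -
  have KM: "K \<subseteq> carrier M" using cover compact_element_closed by auto
  \<comment> \<open>If \<open>b\<close> were disjoint from all of \<open>K\<close>, then
    \<open>compl M b\<close> would bound the join of \<open>K\<close>, which is top.\<close>
  have "\<exists>k\<in>K. b \<sqinter> k \<noteq> \<bottom>"
  proof (rule ccontr)
    assume *: "\<not> ?thesis"
    have "\<Squnion>K \<sqsubseteq> compl M b"
      using * KM b by (intro sup_least) (auto simp: le_compl_iff meet_comm[of _ _ b] subset_iff)
    then have "b \<sqsubseteq> compl M b" using cover b by (metis le_trans top_higher top_closed compl_closed)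
    then show False using le_compl_self b by blast
  qed
  then obtain k where k: "k \<in> K" "b \<sqinter> k \<noteq> \<bottom>" by blast
  have kM: "k \<in> carrier M" "b \<sqinter> k \<in> carrier M" using k KM b by auto
  obtain c where c: "c \<in> mt_AC M" "c \<sqsubseteq> b \<sqinter> k" "c \<noteq> \<bottom>"
    using Hausdorff_AC_below[OF H kM(2) k(2)] by blast
  have cM: "c \<in> carrier M" using c by (simp add: mt_AC_def)
  have cb: "c \<sqsubseteq> b" and ck: "c \<sqsubseteq> k"
    using c b kM cM by (meson le_trans meet_left, meson le_trans meet_right)
  have cc: "compact_element M c"
    using closed_below_compact[OF cM compl_AC_open[OF c(1)] _ ck] k cover by auto
  \<comment> \<open>Closedness, rather than membership in \<open>mt_AC\<close>, is required because
    it passes to arbitrary meets by De Morgan.\<close>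
  define A where "A = {d \<in> carrier M. compl M d \<in> mt_opens M \<and> d \<sqsubseteq> c \<and> d \<noteq> \<bottom>}"
  have "\<exists>m\<in>A. \<forall>a\<in>A. a \<sqsubseteq> m \<longrightarrow> a = m"
  \<comment> \<open>The order is reversed, so that bounds of chains are lower bounds and a maximal
    member is minimal in the lattice.\<close>
  proof (rule predicate_Zorn)
    show "partial_order_on A (relation_of (\<lambda>x y. y \<sqsubseteq> x) A)"
      by (rule partial_order_on_relation_ofI) (auto simp: A_def intro: le_trans le_antisym)
  next
    fix C assume "C \<in> Chains (relation_of (\<lambda>x y. y \<sqsubseteq> x) A)"
    then have C: "C \<subseteq> A" "\<And>x y. \<lbrakk>x \<in> C; y \<in> C\<rbrakk> \<Longrightarrow> x \<sqsubseteq> y \<or> y \<sqsubseteq> x"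
      by (auto simp: Chains_def relation_of_def)
    show "\<exists>u\<in>A. \<forall>a\<in>C. u \<sqsubseteq> a"
    \<comment> \<open>The empty chain is separate: its meet is the top, which need not lie below
      \<open>c\<close>, so \<open>c\<close> itself serves as bound.\<close>
    proof (cases "C = {}")
      case True
      then show ?thesis using c cM compl_AC_open by (auto simp: A_def)
    next
      case False
      have CM: "C \<subseteq> carrier M" using C by (auto simp: A_def)
      have Co: "compl M ` C \<subseteq> mt_opens M" using C by (auto simp: A_def)
      have "\<Sqinter>C \<noteq> \<bottom>"
        using closed_chain_Inf_not_bot[OF cc c(3) CM Co] C by (auto simp: A_def subset_iff)
      moreover have "\<Sqinter>C \<sqsubseteq> c"
      proof -
        obtain d where "d \<in> C" using False by blast
        then have "\<Sqinter>C \<sqsubseteq> d" "d \<sqsubseteq> c" "d \<in> carrier M" using CM C by (auto intro: inf_lower simp: A_def)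
        then show ?thesis using CM cM by (meson le_trans inf_closed)
      qed
      moreover have "compl M (\<Sqinter>C) \<in> mt_opens M" using compl_Inf[OF CM] opens_Sup[OF Co] by simp
      ultimately have "\<Sqinter>C \<in> A" using CM by (simp add: A_def)
      then show ?thesis using CM inf_lower by blast
    qed
  qed
  then obtain m where m: "m \<in> A" "\<And>a. \<lbrakk>a \<in> A; a \<sqsubseteq> m\<rbrakk> \<Longrightarrow> a = m" by blast
  have mM: "m \<in> carrier M" "m \<sqsubseteq> c" "m \<noteq> \<bottom>" using m by (auto simp: A_def)
  have "m \<in> atoms M"
    unfolding atoms_def
  proof (intro CollectI conjI ballI impI)
    fix a assume a: "a \<in> carrier M" "a \<sqsubseteq> m"
    show "a = \<bottom> \<or> a = m"
    proof (rule disjCI)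
      assume "a \<noteq> m"
      show "a = \<bottom>"
      proof (rule ccontr)
        assume "a \<noteq> \<bottom>"
        \<comment> \<open>Minimality of \<open>m\<close> only speaks about closed elements, whereas
          \<open>a\<close> is arbitrary; a closed \<open>d\<close> below \<open>a\<close> must equal
          \<open>m\<close>, which squeezes \<open>a\<close> onto \<open>m\<close>.\<close>
        then obtain d where d: "d \<in> mt_AC M" "d \<sqsubseteq> a" "d \<noteq> \<bottom>"
          using Hausdorff_AC_below[OF H a(1)] by blast
        have dM: "d \<in> carrier M" using d by (simp add: mt_AC_def)
        have dm: "d \<sqsubseteq> m" using d a mM dM by (meson le_trans)
        have "d \<sqsubseteq> c" using le_trans[OF dm mM(2) dM mM(1) cM] .
        then have "d = m" using m(2)[OF _ dm] d dM compl_AC_open by (auto simp: A_def)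
        then show False using a d mM \<open>a \<noteq> m\<close> by (auto intro: le_antisym)
      qed
    qed
  qed (use mM in auto)
  moreover have "m \<sqsubseteq> b" using le_trans[OF mM(2) cb mM(1) cM b(1)] .
  ultimately show ?thesis by blast
qed

end

text \<open>Atomicity is an assumption of its own because it also holds for
  \<open>powerset_mt X\<close> over any space \<open>X\<close>; the translation below thus serves
  algebras from both sources.\<close>

locale spatial_mt = mt +
  assumes spatial: "\<lbrakk>b \<in> carrier M; b \<noteq> \<bottom>\<rbrakk> \<Longrightarrow> \<exists>x\<in>atoms M. x \<sqsubseteq> b"

lemma compact_Hausdorff_spatial:
  assumes "mt_algebra M" "mt_compact M" "mt_Hausdorff M"
  shows "spatial_mt M"
proof -
  interpret mt M using assms by (simp add: mt_iff)
  show ?thesis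
    using atom_below[of "{\<top>\<^bsub>M\<^esub>}"] assms by unfold_locales (auto simp: mt_compact_def)
qed

text \<open>Local compactness at the open element top writes top as a join of opens, each lying
  under a compact element, so the compact elements together cover top.\<close>

lemma locally_compact_Hausdorff_spatial:
  assumes "mt_algebra M" "mt_locally_compact M" "mt_Hausdorff M"
  shows "spatial_mt M"
proof -
  interpret mt M using assms by (simp add: mt_iff)
  let ?V = "{v \<in> mt_opens M. mt_below M v \<top>\<^bsub>M\<^esub>}" and ?K = "Collect (compact_element M)"
  have V: "?V \<subseteq> carrier M" using opens_carrier by auto
  have K: "?K \<subseteq> carrier M" using compact_element_closed by auto
  have "\<top>\<^bsub>M\<^esub> = \<Squnion>\<^bsub>M\<^esub>?V" using assms opens_top unfolding mt_locally_compact_def by blast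
  moreover have "\<Squnion>\<^bsub>M\<^esub>?V \<sqsubseteq>\<^bsub>M\<^esub> \<Squnion>\<^bsub>M\<^esub>?K"
  proof (rule sup_least[OF V sup_closed[OF K]])
    fix v assume v: "v \<in> ?V"
    then obtain k where "compact_element M k" "v \<sqsubseteq>\<^bsub>M\<^esub> k" by (auto simp: mt_below_def)
    then show "v \<sqsubseteq>\<^bsub>M\<^esub> \<Squnion>\<^bsub>M\<^esub>?K" using v V K by (meson CollectI le_trans subsetD sup_closed sup_upper)
  qed
  ultimately have "\<top>\<^bsub>M\<^esub> \<sqsubseteq>\<^bsub>M\<^esub> \<Squnion>\<^bsub>M\<^esub>?K" by simp
  then have "\<Squnion>\<^bsub>M\<^esub>?K = \<top>\<^bsub>M\<^esub>" using K by (intro le_antisym) auto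
  then show ?thesis
    using atom_below[of ?K] assms by unfold_locales auto
qed

section \<open>Translation between an atomic algebra and its space of atoms\<close>

context spatial_mt
begin

text \<open>If \<open>a\<close> is not below \<open>b\<close>, an atom below the nonzero element
  \<open>a \<sqinter> compl M b\<close> separates the two sets of atoms.\<close>

lemma eta_subset_iff:
  assumes "a \<in> carrier M" "b \<in> carrier M"
  shows "eta M a \<subseteq> eta M b \<longleftrightarrow> a \<sqsubseteq> b"
proof
  assume sub: "eta M a \<subseteq> eta M b"
  have "a \<sqinter> compl M b = \<bottom>"
  proof (rule ccontr)
    assume "a \<sqinter> compl M b \<noteq> \<bottom>"
    then obtain x where "x \<in> eta M (a \<sqinter> compl M b)" using spatial[of "a \<sqinter> compl M b"] assms by (auto simp: eta_def)
    then show False using sub assms by (auto simp: eta_meet eta_compl)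
  qed
  then show "a \<sqsubseteq> b" using assms le_compl_iff[of a "compl M b"] by simp
qed (use assms eta_mono in auto)

lemma eta_inject:
  "\<lbrakk>a \<in> carrier M; b \<in> carrier M\<rbrakk> \<Longrightarrow> eta M a = eta M b \<longleftrightarrow> a = b"
  using eta_subset_iff[of a b] eta_subset_iff[of b a] le_antisym[of a b] by auto

lemma Sup_eta: "a \<in> carrier M \<Longrightarrow> \<Squnion>(eta M a) = a"
  using eta_inject[of "\<Squnion>(eta M a)" a] eta_Sup_atoms[of "eta M a"] eta_subset atoms_carrier
  by (meson subset_trans sup_closed)

lemma eta_cases:
  assumes "A \<subseteq> atoms M"
  obtains a where "a \<in> carrier M" "A = eta M a"
  using that[of "\<Squnion>A"] assms eta_Sup_atoms atoms_carrier by auto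

text \<open>By injectivity of \<open>eta\<close>, an open set \<open>eta M a\<close> forces
  \<open>a\<close> itself to be open, not merely to share its atoms with an open element.\<close>

lemma openin_eta: "a \<in> carrier M \<Longrightarrow> openin (at_space M) (eta M a) \<longleftrightarrow> a \<in> mt_opens M"
  using openin_at_space eta_inject opens_closed by metis

text \<open>An open subset of \<open>eta M a\<close> is \<open>eta M u\<close> for an open
  \<open>u\<close>, and for open \<open>u\<close> being below \<open>a\<close> is the same as being
  below \<open>Box M a\<close>.\<close>

lemma eta_Box:
  assumes "a \<in> carrier M"
  shows "eta M (Box M a) = at_space M interior_of eta M a"
proof (rule interior_of_unique[symmetric])
  show "eta M (Box M a) \<subseteq> eta M a" using assms by (simp add: eta_mono Box_le)
  show "openin (at_space M) (eta M (Box M a))" using assms by (simp add: openin_eta Box_opens)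
  fix U assume U: "U \<subseteq> eta M a" "openin (at_space M) U"
  then obtain u where "u \<in> mt_opens M" "U = eta M u" by (auto simp: openin_at_space)
  then show "U \<subseteq> eta M (Box M a)"
    using U assms by (simp add: eta_subset_iff opens_closed open_le_Box)
qed

lemma opens_family_cases:
  assumes "\<And>U. U \<in> \<U> \<Longrightarrow> openin (at_space M) U"
  obtains S where "S \<subseteq> mt_opens M" "\<U> = eta M ` S"
proof -
  have "\<U> \<subseteq> eta M ` mt_opens M" using assms by (auto simp: openin_at_space)
  then show ?thesis using that by (meson subset_imageE)
qed

text \<open>An order embedding that preserves joins and maps the opens onto the open sets carries
  covers and finite subcovers in both directions.\<close>

lemma compact_element_iff:
  assumes a: "a \<in> carrier M"
  shows "compact_element M a \<longleftrightarrow> compactin (at_space M) (eta M a)"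
proof
  assume c: "compact_element M a"
  show "compactin (at_space M) (eta M a)"
    unfolding compactin_def
  proof (intro conjI allI impI)
    fix \<U> assume *: "Ball \<U> (openin (at_space M)) \<and> eta M a \<subseteq> \<Union>\<U>"
    then obtain S where S: "S \<subseteq> mt_opens M" "\<U> = eta M ` S"
      using opens_family_cases[of \<U>] by blast
    have SM: "S \<subseteq> carrier M" using S opens_carrier by blast
    have "a \<sqsubseteq> \<Squnion>S" using * S SM a by (simp flip: eta_subset_iff add: eta_Sup)
    then obtain T where T: "T \<subseteq> S" "finite T" "a \<sqsubseteq> \<Squnion>T" using c S compact_elementD by metis
    have TM: "T \<subseteq> carrier M" using T SM by blast
    have "eta M a \<subseteq> \<Union>(eta M ` T)" using T(3) TM a by (simp flip: eta_subset_iff add: eta_Sup)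
    then show "\<exists>\<F>. finite \<F> \<and> \<F> \<subseteq> \<U> \<and> eta M a \<subseteq> \<Union>\<F>"
      using T S by (intro exI[of _ "eta M ` T"]) auto
  qed (simp add: topspace_at_space eta_subset)
next
  assume c: "compactin (at_space M) (eta M a)"
  show "compact_element M a"
    unfolding compact_element_def
  proof (intro conjI allI impI a)
    fix S assume S: "S \<subseteq> mt_opens M" "a \<sqsubseteq> \<Squnion>S"
    have SM: "S \<subseteq> carrier M" using S opens_carrier by blast
    have "eta M a \<subseteq> \<Union>(eta M ` S)" using S SM a by (simp flip: eta_subset_iff add: eta_Sup)
    moreover have "\<And>U. U \<in> eta M ` S \<Longrightarrow> openin (at_space M) U" using S by (auto simp: openin_at_space)
    ultimately obtain \<F> where "finite \<F>" "\<F> \<subseteq> eta M ` S" "eta M a \<subseteq> \<Union>\<F>"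
      using compactinD[OF c] by metis
    then obtain T where T: "T \<subseteq> S" "finite T" "eta M a \<subseteq> \<Union>(eta M ` T)"
      by (metis finite_subset_image)
    have "T \<subseteq> carrier M" using T SM by blast
    then have "a \<sqsubseteq> \<Squnion>T" using T a by (simp flip: eta_subset_iff add: eta_Sup)
    then show "\<exists>T\<subseteq>S. finite T \<and> a \<sqsubseteq> \<Squnion>T" using T by blast
  qed
qed

lemma saturated_iff:
  assumes a: "a \<in> carrier M"
  shows "mt_saturated M a \<longleftrightarrow> saturatedin (at_space M) (eta M a)"
proof
  assume "mt_saturated M a"
  then obtain S where S: "S \<subseteq> mt_opens M" "a = \<Sqinter>S" by (auto simp: mt_saturated_def)
  have "eta M a = topspace (at_space M) \<inter> \<Inter>(eta M ` S)"
    using S opens_carrier by (simp add: topspace_at_space eta_Inf subset_trans)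
  moreover have "\<forall>U\<in>eta M ` S. openin (at_space M) U" using S by (auto simp: openin_at_space)
  ultimately show "saturatedin (at_space M) (eta M a)" unfolding saturatedin_def by blast
next
  assume "saturatedin (at_space M) (eta M a)"
  then obtain \<U> where U: "\<And>U. U \<in> \<U> \<Longrightarrow> openin (at_space M) U"
    "eta M a = topspace (at_space M) \<inter> \<Inter>\<U>" by (auto simp: saturatedin_def)
  obtain S where S: "S \<subseteq> mt_opens M" "\<U> = eta M ` S" using U(1) by (rule opens_family_cases)
  have SM: "S \<subseteq> carrier M" using S opens_carrier by blast
  have "eta M a = eta M (\<Sqinter>S)" using U S SM by (simp add: topspace_at_space eta_Inf)
  then have "a = \<Sqinter>S" using a SM by (simp add: eta_inject)
  then show "mt_saturated M a" using S unfolding mt_saturated_def by blast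
qed

lemma KS_iff:
  "a \<in> carrier M \<Longrightarrow>
    a \<in> mt_KS M \<longleftrightarrow> compactin (at_space M) (eta M a) \<and> saturatedin (at_space M) (eta M a)"
  by (simp add: mt_KS_def compact_element_iff saturated_iff)

text \<open>A nonzero member of \<open>mt_AC\<close> below an atom \<open>x\<close> is
  \<open>x\<close>, so \<open>x\<close> is the meet of the closures of its open neighbourhoods. A
  different atom \<open>y\<close> escapes one of these closures; the neighbourhood and the
  complement of its closure separate them.\<close>

lemma Hausdorff_at_space:
  assumes "mt_Hausdorff M"
  shows "Hausdorff_space (at_space M)"
  unfolding Hausdorff_space_def topspace_at_space
proof (intro allI impI)
  fix x y assume xy: "x \<in> atoms M \<and> y \<in> atoms M \<and> x \<noteq> y"
  then have M: "x \<in> carrier M" "y \<in> carrier M" using atoms_closed by auto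
  obtain c where c: "c \<in> mt_AC M" "c \<sqsubseteq> x" "c \<noteq> \<bottom>"
    using Hausdorff_AC_below[OF assms M(1)] xy atoms_not_bot by blast
  then have "c = x" using xy atoms_minimal by (simp add: mt_AC_def)
  let ?D = "{Diamond M (Box M d) | d. d \<in> carrier M \<and> x \<sqsubseteq> Box M d}"
  have D: "?D \<subseteq> carrier M" by auto
  have "x = \<Sqinter>?D" using c \<open>c = x\<close> by (simp add: mt_AC_def)
  moreover have "\<not> y \<sqsubseteq> x" using xy M atoms_minimal[of x y] atoms_not_bot by auto
  ultimately obtain d where d: "d \<in> carrier M" "x \<sqsubseteq> Box M d" "\<not> y \<sqsubseteq> Diamond M (Box M d)"
    using atom_le_Inf_iff[of y ?D] D xy by auto
  let ?U = "eta M (Box M d)" and ?V = "eta M (Box M (compl M (Box M d)))"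
  have "openin (at_space M) ?U" "openin (at_space M) ?V" using d by (auto simp: openin_eta Box_opens)
  moreover have "x \<in> ?U" using xy d by (simp add: eta_def)
  moreover have "y \<in> ?V"
    using d xy atom_le_compl_iff[of y "Diamond M (Box M d)"] by (simp add: eta_def compl_Diamond_Box)
  moreover have "disjnt ?U ?V"
    using eta_mono[OF _ _ Box_le[of "compl M (Box M d)"]] d by (auto simp: eta_compl disjnt_iff)
  ultimately show "\<exists>U V. openin (at_space M) U \<and> openin (at_space M) V \<and> x \<in> U \<and> y \<in> V \<and> disjnt U V"
    by blast
qed

lemma mt_compact_iff: "mt_compact M \<longleftrightarrow> compact_space (at_space M)"
  by (simp add: mt_compact_def compact_element_iff compact_space_def eta_top topspace_at_space)

text \<open>The clause for the open element top yields it: by join-primeness an atom lies below a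
  single open \<open>v\<close> under a compact \<open>k\<close>, and \<open>eta\<close> turns these
  into a compact neighbourhood.\<close>

lemma locally_compact_at_space:
  assumes "mt_locally_compact M"
  shows "locally_compact_space (at_space M)"
  unfolding locally_compact_space_def topspace_at_space
proof
  fix x assume x: "x \<in> atoms M"
  let ?V = "{v \<in> mt_opens M. mt_below M v \<top>}"
  have "\<top> = \<Squnion>?V" using assms opens_top unfolding mt_locally_compact_def by blast
  moreover have "x \<sqsubseteq> \<top>" using x atoms_closed by simp
  ultimately have "x \<sqsubseteq> \<Squnion>?V" by metis
  then obtain v k where v: "v \<in> mt_opens M" "x \<sqsubseteq> v" "compact_element M k" "v \<sqsubseteq> k"
    using atom_le_Sup_iff[OF x, of ?V] opens_carrier by (auto simp: mt_below_def)
  have "openin (at_space M) (eta M v)" "compactin (at_space M) (eta M k)" "eta M v \<subseteq> eta M k"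
    using v compact_element_closed compact_element_iff
    by (auto simp: openin_eta opens_closed eta_subset_iff)
  moreover have "x \<in> eta M v" using x v by (simp add: eta_def)
  ultimately show "\<exists>U K. openin (at_space M) U \<and> compactin (at_space M) K \<and> x \<in> U \<and> U \<subseteq> K"
    by blast
qed

text \<open>The algebraic condition asks for compact neighbourhoods inside every open
  \<open>u\<close>, hence the hypothesis of a neighbourhood base instead of
  \<open>locally_compact_space\<close>; for Hausdorff spaces the two agree.\<close>

lemma mt_locally_compactI:
  assumes "neighbourhood_base_of (compactin (at_space M)) (at_space M)"
  shows "mt_locally_compact M"
  unfolding mt_locally_compact_def
proof
  fix u assume u: "u \<in> mt_opens M"
  let ?V = "{v \<in> mt_opens M. mt_below M v u}"
  have VM: "?V \<subseteq> carrier M" using opens_carrier by auto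
  have "eta M u = eta M (\<Squnion>?V)"
  proof
    show "eta M u \<subseteq> eta M (\<Squnion>?V)"
    proof
      fix x assume x: "x \<in> eta M u"
      then obtain V K where VK: "openin (at_space M) V" "compactin (at_space M) K"
        "x \<in> V" "V \<subseteq> K" "K \<subseteq> eta M u"
        using assms u unfolding neighbourhood_base_of by (metis openin_at_space)
      obtain v where v: "v \<in> mt_opens M" "V = eta M v" using VK by (auto simp: openin_at_space)
      obtain k where k: "k \<in> carrier M" "K = eta M k"
        using compactin_subset_topspace[OF VK(2)] eta_cases by (auto simp: topspace_at_space)
      have "v \<in> ?V"
        using v k VK u by (auto simp: mt_below_def compact_element_iff eta_subset_iff opens_closed
            intro!: exI[of _ k])
      then show "x \<in> eta M (\<Squnion>?V)" using VK v VM by (auto simp: eta_Sup)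
    qed
    have "\<Squnion>?V \<sqsubseteq> u"
      using u by (intro sup_least[OF VM])
        (auto simp: opens_closed mt_below_def dest!: compact_element_closed intro: le_trans)
    then show "eta M (\<Squnion>?V) \<subseteq> eta M u" using u VM by (simp add: eta_subset_iff opens_closed)
  qed
  then show "u = \<Squnion>?V" using u VM by (simp add: eta_inject opens_closed)
qed

text \<open>Carried back from the space of atoms, where compact Hausdorff implies a neighbourhood
  base of compact sets.\<close>

lemma compact_Hausdorff_imp_locally_compact:
  assumes "mt_compact M" "mt_Hausdorff M"
  shows "mt_locally_compact M"
  using assms Hausdorff_at_space mt_compact_iff compact_imp_locally_compact_space
    locally_compact_space_neighbourhood_base mt_locally_compactI by blast

end

section \<open>Powerset algebras and morphisms\<close>

lemma powerset_mt_simps [simp]: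
  "carrier (powerset_mt X) = Pow (topspace X)"
  "le (powerset_mt X) = (\<subseteq>)"
  "eq (powerset_mt X) = (=)"
  "Box (powerset_mt X) A = X interior_of A"
  by (simp_all add: powerset_mt_def)

lemma complete_lattice_powerset: "complete_lattice (powerset_mt X)"
proof -
  interpret partial_order "powerset_mt X"
    by unfold_locales auto
  show ?thesis
  proof
    fix S assume S: "S \<subseteq> carrier (powerset_mt X)"
    have "least (powerset_mt X) (\<Union>S) (Upper (powerset_mt X) S)"
      using S by (intro least_UpperI) (auto simp: Upper_def, blast)
    then show "\<exists>s. least (powerset_mt X) s (Upper (powerset_mt X) S)" ..
    \<comment> \<open>The factor \<open>topspace X\<close> gives the correct meet of the empty
      family, whose plain intersection is \<open>UNIV\<close>.\<close>
    have "greatest (powerset_mt X) (topspace X \<inter> \<Inter>S) (Lower (powerset_mt X) S)"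
      using S by (intro greatest_LowerI) (auto simp: Lower_def, blast)
    then show "\<exists>s. greatest (powerset_mt X) s (Lower (powerset_mt X) S)" ..
  qed
qed

context
  fixes X :: "'a topology"
begin

interpretation P: complete_lattice "powerset_mt X"
  by (rule complete_lattice_powerset)

lemma Sup_powerset: "S \<subseteq> Pow (topspace X) \<Longrightarrow> \<Squnion>\<^bsub>powerset_mt X\<^esub>S = \<Union>S"
  using P.sup_upper[of S] P.sup_least[of S "\<Union>S"]
  by (intro equalityI Union_least) (auto intro: Union_upper)

lemma Inf_powerset:
  assumes "S \<subseteq> Pow (topspace X)"
  shows "\<Sqinter>\<^bsub>powerset_mt X\<^esub>S = topspace X \<inter> \<Inter>S"
  using assms P.inf_lower[of S] P.inf_greatest[of S "topspace X \<inter> \<Inter>S"] P.inf_closed[of S]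
  by (intro equalityI Int_greatest Inter_greatest) (auto intro: Inter_lower)

lemma top_powerset [simp]: "\<top>\<^bsub>powerset_mt X\<^esub> = topspace X"
  using P.top_higher[of "topspace X"] P.top_closed by auto

lemma bottom_powerset [simp]: "\<bottom>\<^bsub>powerset_mt X\<^esub> = {}"
  using P.bottom_lower[of "{}"] by auto

lemma join_powerset:
  "\<lbrakk>A \<subseteq> topspace X; B \<subseteq> topspace X\<rbrakk> \<Longrightarrow> A \<squnion>\<^bsub>powerset_mt X\<^esub> B = A \<union> B"
  by (simp add: join_def Sup_powerset)

lemma meet_powerset:
  "\<lbrakk>A \<subseteq> topspace X; B \<subseteq> topspace X\<rbrakk> \<Longrightarrow> A \<sqinter>\<^bsub>powerset_mt X\<^esub> B = A \<inter> B"
  by (auto simp: meet_def Inf_powerset)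

lemma boolean_lattice_powerset: "boolean_lattice (powerset_mt X)"
  unfolding boolean_lattice_def
proof (intro conjI ballI)
  show "bounded_lattice (powerset_mt X)" ..
  fix A assume A: "A \<in> carrier (powerset_mt X)"
  show "\<exists>C\<in>carrier (powerset_mt X). A \<sqinter>\<^bsub>powerset_mt X\<^esub> C = \<bottom>\<^bsub>powerset_mt X\<^esub> \<and>
      A \<squnion>\<^bsub>powerset_mt X\<^esub> C = \<top>\<^bsub>powerset_mt X\<^esub>"
    using A by (intro bexI[of _ "topspace X - A"]) (auto simp: join_powerset meet_powerset)
  fix B C assume "B \<in> carrier (powerset_mt X)" "C \<in> carrier (powerset_mt X)"
  then have "A \<subseteq> topspace X" "B \<subseteq> topspace X" "C \<subseteq> topspace X" using A by auto
  moreover from this have "B \<union> C \<subseteq> topspace X" "A \<inter> B \<subseteq> topspace X" "A \<inter> C \<subseteq> topspace X" by auto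
  ultimately show "A \<sqinter>\<^bsub>powerset_mt X\<^esub> (B \<squnion>\<^bsub>powerset_mt X\<^esub> C) =
      (A \<sqinter>\<^bsub>powerset_mt X\<^esub> B) \<squnion>\<^bsub>powerset_mt X\<^esub> (A \<sqinter>\<^bsub>powerset_mt X\<^esub> C)"
    by (simp only: join_powerset meet_powerset Int_Un_distrib)
qed

lemma mt_algebra_powerset: "mt_algebra (powerset_mt X)"
  unfolding mt_algebra_def
  using complete_lattice_powerset boolean_lattice_powerset interior_of_subset_topspace[of X]
  by (auto simp: meet_powerset interior_of_Int interior_of_subset)

interpretation P: mt "powerset_mt X"
  using mt_algebra_powerset by (simp add: mt_iff)

lemma compl_powerset: "A \<subseteq> topspace X \<Longrightarrow> compl (powerset_mt X) A = topspace X - A"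
  by (rule P.compl_eqI) (auto simp: join_powerset meet_powerset)

lemma mt_opens_powerset: "mt_opens (powerset_mt X) = {U. openin X U}"
proof -
  have "U = X interior_of U \<longleftrightarrow> openin X U" for U by (metis interior_of_eq)
  then show ?thesis using openin_subset[of X] by (simp add: mt_opens_def) blast
qed

lemma Diamond_powerset: "A \<subseteq> topspace X \<Longrightarrow> Diamond (powerset_mt X) A = X closure_of A"
  by (simp add: Diamond_def compl_powerset interior_of_subset_topspace closure_of_interior_of)

lemma atoms_powerset: "atoms (powerset_mt X) = (\<lambda>x. {x}) ` topspace X"
proof
  show "atoms (powerset_mt X) \<subseteq> (\<lambda>x. {x}) ` topspace X"
  proof
    fix A assume A: "A \<in> atoms (powerset_mt X)"
    then obtain x where "x \<in> A" "A \<subseteq> topspace X" by (auto simp: atoms_def)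
    moreover from this have "{x} = A" using A by (intro P.atoms_minimal) auto
    ultimately show "A \<in> (\<lambda>x. {x}) ` topspace X" by auto
  qed
qed (auto simp: atoms_def subset_singleton_iff)

lemma eta_powerset: "A \<subseteq> topspace X \<Longrightarrow> eta (powerset_mt X) A = (\<lambda>x. {x}) ` A"
  by (auto simp: eta_def atoms_powerset)

lemma spatial_powerset: "spatial_mt (powerset_mt X)"
  by unfold_locales (auto simp: atoms_powerset)

text \<open>The two definitions match conjunct by conjunct once joins of open families are read as
  unions; both place \<open>K\<close> inside the space.\<close>

lemma compact_element_powerset: "compact_element (powerset_mt X) K \<longleftrightarrow> compactin X K"
proof -
  have *: "\<Squnion>\<^bsub>powerset_mt X\<^esub>S = \<Union>S" if "S \<subseteq> {U. openin X U}" for S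
    using that openin_subset by (intro Sup_powerset) blast
  have eq: "T \<subseteq> S \<and> finite T \<and> K \<subseteq> \<Squnion>\<^bsub>powerset_mt X\<^esub>T \<longleftrightarrow> finite T \<and> T \<subseteq> S \<and> K \<subseteq> \<Union>T"
    if "S \<subseteq> {U. openin X U}" for S T
    using *[of T] that by (metis subset_trans)
  show ?thesis
    unfolding compact_element_def compactin_def mt_opens_powerset
  proof (intro arg_cong2[where f = "(\<and>)"] iff_allI)
    fix S
    show "(S \<subseteq> {U. openin X U} \<longrightarrow> K \<sqsubseteq>\<^bsub>powerset_mt X\<^esub> \<Squnion>\<^bsub>powerset_mt X\<^esub>S \<longrightarrow>
          (\<exists>T\<subseteq>S. finite T \<and> K \<sqsubseteq>\<^bsub>powerset_mt X\<^esub> \<Squnion>\<^bsub>powerset_mt X\<^esub>T)) \<longleftrightarrow>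
        (Ball S (openin X) \<and> K \<subseteq> \<Union>S \<longrightarrow> (\<exists>\<F>. finite \<F> \<and> \<F> \<subseteq> S \<and> K \<subseteq> \<Union>\<F>))"
    proof (cases "S \<subseteq> {U. openin X U}")
      case True
      then show ?thesis by (simp add: eq *) blast
    qed auto
  qed simp
qed

lemma saturated_powerset: "mt_saturated (powerset_mt X) K \<longleftrightarrow> saturatedin X K"
proof -
  have *: "\<Sqinter>\<^bsub>powerset_mt X\<^esub>S = topspace X \<inter> \<Inter>S" if "S \<subseteq> {U. openin X U}" for S
    using that openin_subset by (intro Inf_powerset) blast
  show ?thesis
    unfolding mt_saturated_def saturatedin_def mt_opens_powerset
  proof
    assume "\<exists>S\<subseteq>{U. openin X U}. K = \<Sqinter>\<^bsub>powerset_mt X\<^esub>S"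
    then obtain S where "S \<subseteq> {U. openin X U}" "K = \<Sqinter>\<^bsub>powerset_mt X\<^esub>S" by blast
    then show "\<exists>\<U>. (\<forall>U\<in>\<U>. openin X U) \<and> K = topspace X \<inter> \<Inter>\<U>"
      using *[of S] by (intro exI[of _ S]) auto
  next
    assume "\<exists>\<U>. (\<forall>U\<in>\<U>. openin X U) \<and> K = topspace X \<inter> \<Inter>\<U>"
    then obtain S where "\<forall>U\<in>S. openin X U" "K = topspace X \<inter> \<Inter>S" by blast
    then show "\<exists>S\<subseteq>{U. openin X U}. K = \<Sqinter>\<^bsub>powerset_mt X\<^esub>S"
      using *[of S] by (intro exI[of _ S]) auto
  qed
qed

lemma mt_KS_powerset: "mt_KS (powerset_mt X) = {K. compactin X K \<and> saturatedin X K}"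
  using compactin_subset_topspace
  by (auto simp: mt_KS_def compact_element_powerset saturated_powerset)

lemma mt_compact_powerset: "compact_space X \<Longrightarrow> mt_compact (powerset_mt X)"
  by (simp add: mt_compact_def compact_element_powerset compact_space_def)

text \<open>In a Hausdorff space a point is the intersection of the closures of its open
  neighbourhoods, so singletons belong to \<open>mt_AC\<close>; every set is a union of
  singletons.\<close>

lemma mt_Hausdorff_powerset:
  assumes "Hausdorff_space X"
  shows "mt_Hausdorff (powerset_mt X)"
proof -
  have AC: "{x} \<in> mt_AC (powerset_mt X)" if x: "x \<in> topspace X" for x
  proof -
    let ?D = "{Diamond (powerset_mt X) (X interior_of c) | c. c \<subseteq> topspace X \<and> {x} \<subseteq> X interior_of c}"
    have D: "?D = {X closure_of (X interior_of c) | c. c \<subseteq> topspace X \<and> x \<in> X interior_of c}"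
      using interior_of_subset_topspace[of X] by (auto simp: Diamond_powerset)
    have "{x} = topspace X \<inter> \<Inter>?D"
    proof
      show "{x} \<subseteq> topspace X \<inter> \<Inter>?D"
        unfolding D using x closure_of_subset[OF interior_of_subset_topspace[of X]] by blast
      show "topspace X \<inter> \<Inter>?D \<subseteq> {x}"
      proof
        fix y assume y: "y \<in> topspace X \<inter> \<Inter>?D"
        show "y \<in> {x}"
        proof (rule ccontr)
          assume "y \<notin> {x}"
          then have "x \<noteq> y" "y \<in> topspace X" using y by auto
          then obtain U V where UV: "openin X U" "openin X V" "x \<in> U" "y \<in> V" "disjnt U V"
            using assms x unfolding Hausdorff_space_def by meson
          then have "X closure_of U \<in> ?D"
            unfolding D using openin_subset[of X U] by (auto simp: interior_of_openin intro!: exI[of _ U])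
          then have "y \<in> X closure_of U" using y by blast
          then show False using UV by (auto simp: in_closure_of disjnt_iff)
        qed
      qed
    qed
    moreover have "?D \<subseteq> Pow (topspace X)" 
      unfolding D using closure_of_subset_topspace[of X] by blast
    ultimately have "{x} = \<Sqinter>\<^bsub>powerset_mt X\<^esub>?D" by (simp only: Inf_powerset)
    then show ?thesis
      unfolding mt_AC_def powerset_mt_simps Pow_iff using x by blast
  qed
  show ?thesis
    unfolding mt_Hausdorff_def
  proof
    fix A assume "A \<in> carrier (powerset_mt X)"
    then have A: "A \<subseteq> topspace X" by simp
    then have "(\<lambda>x. {x}) ` A \<subseteq> mt_AC (powerset_mt X)" using AC by blast
    moreover have "A = \<Squnion>\<^bsub>powerset_mt X\<^esub>((\<lambda>x. {x}) ` A)" using A by (subst Sup_powerset) auto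
    ultimately show "\<exists>S\<subseteq>mt_AC (powerset_mt X). A = \<Squnion>\<^bsub>powerset_mt X\<^esub>S" by blast
  qed
qed

text \<open>Hausdorffness upgrades one compact neighbourhood per point to a neighbourhood base of
  compact sets, which is what the algebraic condition expresses.\<close>

lemma mt_locally_compact_powerset:
  assumes "locally_compact_space X" "Hausdorff_space X"
  shows "mt_locally_compact (powerset_mt X)"
  unfolding mt_locally_compact_def mt_opens_powerset
proof
  fix U assume "U \<in> {U. openin X U}"
  then have U: "openin X U" by simp
  let ?V = "{V \<in> {U. openin X U}. mt_below (powerset_mt X) V U}"
  have "neighbourhood_base_of (compactin X) X"
    using assms locally_compact_space_neighbourhood_base by blast
  then have "\<exists>V K. openin X V \<and> compactin X K \<and> x \<in> V \<and> V \<subseteq> K \<and> K \<subseteq> U" if "x \<in> U" for x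
    using U that unfolding neighbourhood_base_of by blast
  then have "U = \<Union>?V"
    by (fastforce simp: mt_below_def compact_element_powerset)
  moreover have "?V \<subseteq> Pow (topspace X)" using openin_subset by blast
  ultimately show "U = \<Squnion>\<^bsub>powerset_mt X\<^esub>?V" by (simp add: Sup_powerset)
qed

end

section \<open>MT-morphisms and their left adjoints on atoms\<close>

lemma mt_homD:
  assumes "f \<in> mt_hom M N"
  shows "f \<in> carrier M \<rightarrow>\<^sub>E carrier N"
    and "S \<subseteq> carrier M \<Longrightarrow> f (\<Squnion>\<^bsub>M\<^esub>S) = \<Squnion>\<^bsub>N\<^esub>(f ` S)"
    and "S \<subseteq> carrier M \<Longrightarrow> f (\<Sqinter>\<^bsub>M\<^esub>S) = \<Sqinter>\<^bsub>N\<^esub>(f ` S)"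
    and "a \<in> carrier M \<Longrightarrow> f (compl M a) = compl N (f a)"
    and "a \<in> carrier M \<Longrightarrow> f (Box M a) \<sqsubseteq>\<^bsub>N\<^esub> Box N (f a)"
    and "a \<in> carrier M \<Longrightarrow> f a \<in> carrier N"
  using assms by (auto simp: mt_hom_def)

lemma mt_homI:
  assumes "f \<in> carrier M \<rightarrow>\<^sub>E carrier N"
    and "\<And>S. S \<subseteq> carrier M \<Longrightarrow> f (\<Squnion>\<^bsub>M\<^esub>S) = \<Squnion>\<^bsub>N\<^esub>(f ` S)"
    and "\<And>S. S \<subseteq> carrier M \<Longrightarrow> f (\<Sqinter>\<^bsub>M\<^esub>S) = \<Sqinter>\<^bsub>N\<^esub>(f ` S)"
    and "\<And>a. a \<in> carrier M \<Longrightarrow> f (compl M a) = compl N (f a)"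
    and "\<And>a. a \<in> carrier M \<Longrightarrow> f (Box M a) \<sqsubseteq>\<^bsub>N\<^esub> Box N (f a)"
  shows "f \<in> mt_hom M N"
  using assms by (auto simp: mt_hom_def)

locale mt_morphism = M: mt M + N: mt N
  for M :: "'a mt" and N :: "'b mt" +
  fixes f
  assumes hom: "f \<in> mt_hom M N"
begin

lemmas hom_closed = mt_homD(6)[OF hom]
  and hom_Sup = mt_homD(2)[OF hom]
  and hom_Inf = mt_homD(3)[OF hom]
  and hom_compl = mt_homD(4)[OF hom]
  and hom_Box = mt_homD(5)[OF hom]

lemma hom_mono: "\<lbrakk>a \<in> carrier M; b \<in> carrier M; a \<sqsubseteq>\<^bsub>M\<^esub> b\<rbrakk> \<Longrightarrow> f a \<sqsubseteq>\<^bsub>N\<^esub> f b"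
  using hom_Inf[of "{a, b}"] M.le_iff_join[of a b] N.le_iff_join[of "f a" "f b"] hom_closed
  by (simp add: meet_def)

lemma hom_bot: "f \<bottom>\<^bsub>M\<^esub> = \<bottom>\<^bsub>N\<^esub>"
  using hom_Sup[of "{}"] by simp

lemma hom_opens: "u \<in> mt_opens M \<Longrightarrow> f u \<in> mt_opens N"
  using hom_Box[of u] hom_closed by (intro N.opensI) (auto simp: mt_opens_def)

lemma left_adj_closed: "left_adj M N f x \<in> carrier M"
  unfolding left_adj_def by (rule M.inf_closed) auto

text \<open>Because \<open>f\<close> preserves the meet that defines \<open>left_adj\<close>, the
  element \<open>x\<close> lies below \<open>f (left_adj M N f x)\<close>; this gives the nontrivial
  half of the adjunction.\<close>

lemma left_adj_le_iff:
  assumes "x \<in> carrier N" "a \<in> carrier M"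
  shows "left_adj M N f x \<sqsubseteq>\<^bsub>M\<^esub> a \<longleftrightarrow> x \<sqsubseteq>\<^bsub>N\<^esub> f a"
proof
  let ?A = "{a \<in> carrier M. x \<sqsubseteq>\<^bsub>N\<^esub> f a}"
  have A: "?A \<subseteq> carrier M" "f ` ?A \<subseteq> carrier N" using hom_closed by auto
  have "x \<sqsubseteq>\<^bsub>N\<^esub> f (left_adj M N f x)"
    unfolding left_adj_def hom_Inf[OF A(1)] using A(2) assms by (intro N.inf_greatest) auto
  moreover assume "left_adj M N f x \<sqsubseteq>\<^bsub>M\<^esub> a"
  ultimately show "x \<sqsubseteq>\<^bsub>N\<^esub> f a"
    using assms left_adj_closed hom_mono hom_closed N.le_trans by meson
next
  assume "x \<sqsubseteq>\<^bsub>N\<^esub> f a"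
  then show "left_adj M N f x \<sqsubseteq>\<^bsub>M\<^esub> a"
    unfolding left_adj_def using assms by (intro M.inf_lower) auto
qed

text \<open>It is nonzero since \<open>f\<close> preserves bottom. For minimality, an atom
  \<open>x\<close> lies below \<open>f a\<close> or below its complement
  \<open>f (compl M a)\<close>; by adjunction the image of \<open>x\<close> lies below
  \<open>a\<close> or below \<open>compl M a\<close>, and the latter makes any \<open>a\<close>
  under it bottom.\<close>

lemma left_adj_atom:
  assumes x: "x \<in> atoms N"
  shows "left_adj M N f x \<in> atoms M"
proof -
  let ?p = "left_adj M N f x"
  have xN: "x \<in> carrier N" using x N.atoms_closed by blast
  have "?p \<noteq> \<bottom>\<^bsub>M\<^esub>"
  proof
    assume "?p = \<bottom>\<^bsub>M\<^esub>"
    then have "x \<sqsubseteq>\<^bsub>N\<^esub> \<bottom>\<^bsub>N\<^esub>" using left_adj_le_iff[OF xN, of "\<bottom>\<^bsub>M\<^esub>"] by (simp add: hom_bot)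
    then show False using x xN N.le_bot_iff N.atoms_not_bot by blast
  qed
  moreover have "a = \<bottom>\<^bsub>M\<^esub> \<or> a = ?p" if a: "a \<in> carrier M" "a \<sqsubseteq>\<^bsub>M\<^esub> ?p" for a
  proof (cases "x \<sqsubseteq>\<^bsub>N\<^esub> f a")
    case True
    then have "?p \<sqsubseteq>\<^bsub>M\<^esub> a" using left_adj_le_iff xN a by blast
    then show ?thesis using a left_adj_closed by (auto intro: M.le_antisym)
  next
    case False
    then have "x \<sqsubseteq>\<^bsub>N\<^esub> f (compl M a)"
      using a x by (simp add: hom_compl hom_closed N.atom_le_compl_iff)
    then have "?p \<sqsubseteq>\<^bsub>M\<^esub> compl M a" using left_adj_le_iff xN a by simp
    then have "a \<sqsubseteq>\<^bsub>M\<^esub> compl M a"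
      using M.le_trans[OF a(2) _ a(1) left_adj_closed] a by simp
    then show ?thesis using M.le_compl_self a by blast
  qed
  ultimately show ?thesis using left_adj_closed by (simp add: atoms_def)
qed

lemma left_adj_in_eta_iff:
  "\<lbrakk>x \<in> atoms N; a \<in> carrier M\<rbrakk> \<Longrightarrow> left_adj M N f x \<in> eta M a \<longleftrightarrow> x \<in> eta N (f a)"
  using left_adj_atom left_adj_le_iff N.atoms_closed by (simp add: eta_def)

text \<open>This is the value of \<open>at_functor\<close> at \<open>f\<close>, named where the
  properties of \<open>f\<close> are available.\<close>

definition at_map :: "'b \<Rightarrow> 'a" where
  "at_map = (\<lambda>x\<in>atoms N. left_adj M N f x)"

text \<open>The adjunction restricted to atoms. Continuity and properness of \<open>at_map\<close>,
  and later the naturality of \<open>eta\<close>, are all instances of it.\<close>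

lemma at_map_eta_preimage:
  "a \<in> carrier M \<Longrightarrow>
    {x \<in> topspace (at_space N). at_map x \<in> eta M a} = eta N (f a)"
  using left_adj_in_eta_iff N.eta_subset by (auto simp: at_map_def N.topspace_at_space)

lemma at_map_continuous_hom: "at_map \<in> continuous_hom (at_space N) (at_space M)"
  unfolding continuous_hom_def
proof (intro CollectI conjI)
  show E: "at_map \<in> topspace (at_space N) \<rightarrow>\<^sub>E topspace (at_space M)"
    using left_adj_atom by (auto simp: at_map_def M.topspace_at_space N.topspace_at_space)
  show "continuous_map (at_space N) (at_space M) at_map"
    unfolding continuous_map_def
  proof (intro conjI allI impI)
    fix U assume "openin (at_space M) U"
    then obtain u where "u \<in> mt_opens M" "U = eta M u" by (auto simp: M.openin_at_space)
    then show "openin (at_space N) {x \<in> topspace (at_space N). at_map x \<in> U}"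
      using hom_opens by (auto simp: at_map_eta_preimage M.opens_closed N.openin_at_space)
  qed (use E in auto)
qed

text \<open>Atomicity of both algebras lets a compact saturated set be written as
  \<open>eta M a\<close> with \<open>a\<close> in \<open>mt_KS M\<close>, and its preimage
  \<open>eta N (f a)\<close> be recognised as compact.\<close>

lemma at_map_proper_hom:
  assumes "spatial_mt M" "spatial_mt N" "f \<in> proper_mt_hom M N"
  shows "at_map \<in> proper_hom (at_space N) (at_space M)"
  unfolding proper_hom_def
proof (intro CollectI conjI allI impI at_map_continuous_hom)
  interpret M: spatial_mt M by fact
  interpret N: spatial_mt N by fact
  fix K assume K: "compactin (at_space M) K \<and> saturatedin (at_space M) K"
  then have "K \<subseteq> atoms M" using compactin_subset_topspace M.topspace_at_space by blast
  then obtain a where a: "a \<in> carrier M" "K = eta M a" by (rule M.eta_cases)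
  then have "f a \<in> mt_KS N" using assms K by (simp add: proper_mt_hom_def M.KS_iff)
  then show "compactin (at_space N) {x \<in> topspace (at_space N). at_map x \<in> K}"
    using a by (simp add: at_map_eta_preimage hom_closed N.KS_iff)
qed

end

text \<open>An order-theoretic Yoneda principle: with \<open>left_adj_le_iff\<close> it identifies
  left adjoints through what lies above them.\<close>

lemma (in mt) le_unique:
  assumes "p \<in> carrier M" "q \<in> carrier M" "\<And>a. a \<in> carrier M \<Longrightarrow> p \<sqsubseteq> a \<longleftrightarrow> q \<sqsubseteq> a"
  shows "p = q"
  using assms by (auto intro!: le_antisym)

section \<open>Identities, composites and inverses of MT-morphisms\<close>

lemma mt_hom_id:
  assumes "mt M"
  shows "(\<lambda>a\<in>carrier M. a) \<in> mt_hom M M"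
proof -
  interpret mt M by fact
  have "(\<lambda>a\<in>carrier M. a) ` S = S" if "S \<subseteq> carrier M" for S using that by force
  then show ?thesis by (intro mt_homI) auto
qed

lemma mt_hom_compose:
  assumes "mt M" "mt N" "mt L" "f \<in> mt_hom M N" "g \<in> mt_hom N L"
  shows "compose (carrier M) g f \<in> mt_hom M L"
proof -
  interpret M: mt M by fact
  interpret N: mt N by fact
  interpret L: mt L by fact
  interpret f: mt_morphism M N f using assms by unfold_locales
  interpret g: mt_morphism N L g using assms by unfold_locales
  have im: "compose (carrier M) g f ` S = g ` f ` S" "f ` S \<subseteq> carrier N" if "S \<subseteq> carrier M" for S
    using that f.hom_closed by (force simp: compose_def)+
  show ?thesis
  proof (rule mt_homI)
    show "compose (carrier M) g f \<in> carrier M \<rightarrow>\<^sub>E carrier L"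
      using f.hom_closed g.hom_closed by (auto simp: compose_def)
    fix a assume a: "a \<in> carrier M"
    have "g (f (Box M a)) \<sqsubseteq>\<^bsub>L\<^esub> g (Box N (f a))"
      using a f.hom_Box f.hom_closed by (intro g.hom_mono) auto
    moreover have "g (Box N (f a)) \<sqsubseteq>\<^bsub>L\<^esub> Box L (g (f a))" using a f.hom_closed g.hom_Box by blast
    ultimately have "g (f (Box M a)) \<sqsubseteq>\<^bsub>L\<^esub> Box L (g (f a))"
      using a f.hom_closed g.hom_closed by (auto intro: L.le_trans)
    then show "compose (carrier M) g f (Box M a) \<sqsubseteq>\<^bsub>L\<^esub> Box L (compose (carrier M) g f a)"
      using a by (simp add: compose_def)
  next
    fix S assume S: "S \<subseteq> carrier M"
    show "compose (carrier M) g f (\<Squnion>\<^bsub>M\<^esub>S) = \<Squnion>\<^bsub>L\<^esub>(compose (carrier M) g f ` S)"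
      unfolding im(1)[OF S] using S im(2)[OF S] by (simp add: compose_eq f.hom_Sup g.hom_Sup)
    show "compose (carrier M) g f (\<Sqinter>\<^bsub>M\<^esub>S) = \<Sqinter>\<^bsub>L\<^esub>(compose (carrier M) g f ` S)"
      unfolding im(1)[OF S] using S im(2)[OF S] by (simp add: compose_eq f.hom_Inf g.hom_Inf)
  qed (simp_all add: compose_eq f.hom_compl g.hom_compl f.hom_closed)
qed

text \<open>Joins, meets and complements pass to the inverse automatically. The law for
  \<open>Box\<close> is only an inequality, so it is assumed for the inverse, just as a continuous
  bijection need not have a continuous inverse.\<close>

lemma mt_hom_inverse:
  assumes "mt M" "mt N" "f \<in> mt_hom M N"
    and g: "g \<in> carrier N \<rightarrow>\<^sub>E carrier M"
    and gf: "\<And>a. a \<in> carrier M \<Longrightarrow> g (f a) = a" and fg: "\<And>b. b \<in> carrier N \<Longrightarrow> f (g b) = b"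
    and Box: "\<And>b. b \<in> carrier N \<Longrightarrow> g (Box N b) \<sqsubseteq>\<^bsub>M\<^esub> Box M (g b)"
  shows "g \<in> mt_hom N M"
proof -
  interpret M: mt M by fact
  interpret N: mt N by fact
  interpret f: mt_morphism M N f using assms by unfold_locales
  have gM: "g b \<in> carrier M" if "b \<in> carrier N" for b using g that by auto
  have im: "f ` g ` S = S" "g ` S \<subseteq> carrier M" if "S \<subseteq> carrier N" for S
  proof -
    have "(\<lambda>b. f (g b)) ` S = (\<lambda>b. b) ` S" using that fg by (intro image_cong) auto
    then show "f ` g ` S = S" by (simp add: image_image)
    show "g ` S \<subseteq> carrier M" using that gM by auto
  qed
  show ?thesis
  proof (rule mt_homI[OF g _ _ _ Box])
    fix S assume S: "S \<subseteq> carrier N"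
    have "g (\<Squnion>\<^bsub>N\<^esub>S) = g (f (\<Squnion>\<^bsub>M\<^esub>(g ` S)))" using S im by (simp add: f.hom_Sup)
    then show "g (\<Squnion>\<^bsub>N\<^esub>S) = \<Squnion>\<^bsub>M\<^esub>(g ` S)" using S im gf by simp
    have "g (\<Sqinter>\<^bsub>N\<^esub>S) = g (f (\<Sqinter>\<^bsub>M\<^esub>(g ` S)))" using S im by (simp add: f.hom_Inf)
    then show "g (\<Sqinter>\<^bsub>N\<^esub>S) = \<Sqinter>\<^bsub>M\<^esub>(g ` S)" using S im gf by simp
  next
    fix b assume b: "b \<in> carrier N"
    have "g (compl N b) = g (f (compl M (g b)))" using b gM fg by (simp add: f.hom_compl)
    then show "g (compl N b) = compl M (g b)" using b gM gf by simp
  qed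
qed

text \<open>Compact elements of \<open>M\<close> are closed because its space of atoms is Hausdorff;
  morphisms preserve closed elements, and these are compact in the compact \<open>N\<close>.
  Saturation survives because \<open>f\<close> preserves opens and meets.\<close>

lemma proper_mt_hom_compact_Hausdorff:
  assumes "mt_algebra M" "mt_compact M" "mt_Hausdorff M"
    and "mt_algebra N" "mt_compact N" "mt_Hausdorff N"
  shows "proper_mt_hom M N = mt_hom M N"
proof -
  interpret M: spatial_mt M using assms compact_Hausdorff_spatial by blast
  interpret N: spatial_mt N using assms compact_Hausdorff_spatial by blast
  have "f a \<in> mt_KS N" if f: "f \<in> mt_hom M N" and a: "a \<in> mt_KS M" for f a
  proof -
    interpret mt_morphism M N f using f by unfold_locales
    have aM: "a \<in> carrier M" using a by (simp add: mt_KS_def)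
    have "closedin (at_space M) (eta M a)"
      using a aM M.KS_iff compactin_imp_closedin[OF M.Hausdorff_at_space] assms by blast
    then have "compl M a \<in> mt_opens M"
      using aM by (simp add: closedin_def M.topspace_at_space flip: M.eta_compl M.openin_eta)
    then have "compl N (f a) \<in> mt_opens N" using hom_opens aM by (metis hom_compl)
    then have c: "compact_element N (f a)"
      using aM assms hom_closed N.closed_below_compact[of "f a" "\<top>\<^bsub>N\<^esub>"] by (simp add: mt_compact_def)
    obtain S where S: "S \<subseteq> mt_opens M" "a = \<Sqinter>\<^bsub>M\<^esub>S" using a by (auto simp: mt_KS_def mt_saturated_def)
    then have "f a = \<Sqinter>\<^bsub>N\<^esub>(f ` S)" using M.opens_carrier by (auto intro!: hom_Inf)
    moreover have "f ` S \<subseteq> mt_opens N" using S hom_opens by auto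
    ultimately have "mt_saturated N (f a)" unfolding mt_saturated_def by blast
    then show ?thesis using c aM hom_closed by (simp add: mt_KS_def)
  qed
  then show ?thesis by (auto simp: proper_mt_hom_def)
qed

lemma proper_hom_compact_Hausdorff:
  assumes "compact_space X" "Hausdorff_space Y"
  shows "proper_hom X Y = continuous_hom X Y"
proof -
  have "compactin X {x \<in> topspace X. f x \<in> K}" if "f \<in> continuous_hom X Y" "compactin Y K" for f K
    using that assms compactin_imp_closedin[of Y K] closedin_compact_space
      closedin_continuous_map_preimage[of X Y f K]
    by (auto simp: continuous_hom_def)
  then show ?thesis by (auto simp: proper_hom_def)
qed

text \<open>\<open>proper_hom\<close> only asks preimages to be compact; this supplies the
  saturation demanded by \<open>mt_KS\<close> and by taking a second preimage in a
  composite.\<close>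

lemma saturatedin_preimage:
  assumes f: "continuous_map X Y f" and K: "saturatedin Y K"
  shows "saturatedin X {x \<in> topspace X. f x \<in> K}"
proof -
  obtain \<U> where U: "\<forall>U\<in>\<U>. openin Y U" "K = topspace Y \<inter> \<Inter>\<U>"
    using K by (auto simp: saturatedin_def)
  let ?\<V> = "(\<lambda>U. {x \<in> topspace X. f x \<in> U}) ` \<U>"
  have "{x \<in> topspace X. f x \<in> K} = topspace X \<inter> \<Inter>?\<V>"
    using U f continuous_map_image_subset_topspace by fastforce
  moreover have "\<forall>V\<in>?\<V>. openin X V" using U f openin_continuous_map_preimage by blast
  ultimately show ?thesis unfolding saturatedin_def by blast
qed

section \<open>Preimage maps as MT-morphisms\<close>

lemma powerset_functor_mt_hom:
  assumes "f \<in> continuous_hom X Y"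
  shows "on_hom powerset_functor X Y f \<in> mt_hom (powerset_mt Y) (powerset_mt X)"
proof -
  have f: "continuous_map X Y f" using assms by (simp add: continuous_hom_def)
  have fY: "f x \<in> topspace Y" if "x \<in> topspace X" for x
    using that f continuous_map_image_subset_topspace by fastforce
  let ?P = "\<lambda>B\<in>Pow (topspace Y). {x \<in> topspace X. f x \<in> B}"
  have im: "?P ` S = (\<lambda>B. {x \<in> topspace X. f x \<in> B}) ` S" if "S \<subseteq> Pow (topspace Y)" for S
    using that by (intro image_cong) auto
  have "?P \<in> mt_hom (powerset_mt Y) (powerset_mt X)"
  proof (rule mt_homI)
    fix S assume "S \<subseteq> carrier (powerset_mt Y)"
    then have S: "S \<subseteq> Pow (topspace Y)" by simp
    then have imS: "?P ` S \<subseteq> Pow (topspace X)" unfolding im[OF S] by auto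
    have "\<Union>S \<subseteq> topspace Y" using S by auto
    then show "?P (\<Squnion>\<^bsub>powerset_mt Y\<^esub>S) = \<Squnion>\<^bsub>powerset_mt X\<^esub>(?P ` S)"
      unfolding Sup_powerset[OF S] Sup_powerset[OF imS] unfolding im[OF S] by auto
    show "?P (\<Sqinter>\<^bsub>powerset_mt Y\<^esub>S) = \<Sqinter>\<^bsub>powerset_mt X\<^esub>(?P ` S)"
      unfolding Inf_powerset[OF S] Inf_powerset[OF imS] unfolding im[OF S] using fY by auto
  next
    fix B assume "B \<in> carrier (powerset_mt Y)"
    then have B: "B \<subseteq> topspace Y" by simp
    have "{x \<in> topspace X. f x \<in> B} \<subseteq> topspace X" by auto
    from compl_powerset[OF this] B show "?P (compl (powerset_mt Y) B) = compl (powerset_mt X) (?P B)"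
      using fY by (auto simp: compl_powerset)
    \<comment> \<open>The law for \<open>Box\<close> is continuity: the preimage of the interior is
      an open subset of the preimage, hence inside its interior.\<close>
    have "openin X {x \<in> topspace X. f x \<in> Y interior_of B}"
      using f by (intro openin_continuous_map_preimage) auto
    moreover have "{x \<in> topspace X. f x \<in> Y interior_of B} \<subseteq> {x \<in> topspace X. f x \<in> B}"
      using interior_of_subset[of Y B] by auto
    ultimately show "?P (Box (powerset_mt Y) B) \<sqsubseteq>\<^bsub>powerset_mt X\<^esub> Box (powerset_mt X) (?P B)"
      using B interior_of_subset_topspace[of Y B] by (simp add: interior_of_maximal)
  qed auto
  then show ?thesis by (simp add: powerset_functor_def)
qed

lemma powerset_functor_proper_mt_hom:
  assumes "f \<in> proper_hom X Y"
  shows "on_hom powerset_functor X Y f \<in> proper_mt_hom (powerset_mt Y) (powerset_mt X)"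
proof -
  have f: "f \<in> continuous_hom X Y" using assms by (simp add: proper_hom_def)
  have "on_hom powerset_functor X Y f K = {x \<in> topspace X. f x \<in> K}" if "compactin Y K" for K
    using compactin_subset_topspace[OF that] by (simp add: powerset_functor_def)
  then show ?thesis
    using assms powerset_functor_mt_hom[OF f] saturatedin_preimage[of X Y f] f
    by (auto simp: proper_mt_hom_def mt_KS_powerset proper_hom_def continuous_hom_def)
qed

section \<open>The dual equivalences\<close>

text \<open>The preimage of \<open>K\<close> is the image of \<open>K\<close> under the continuous
  inverse, hence compact. Exchanging \<open>f\<close> and \<open>g\<close> makes every homeomorphism
  an isomorphism for proper maps.\<close>

lemma inverse_proper_hom:
  assumes f: "f \<in> continuous_hom X Y" and g: "g \<in> continuous_hom Y X"
    and gf: "\<And>x. x \<in> topspace X \<Longrightarrow> g (f x) = x" and fg: "\<And>y. y \<in> topspace Y \<Longrightarrow> f (g y) = y"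
  shows "f \<in> proper_hom X Y"
  unfolding proper_hom_def
proof (intro CollectI conjI allI impI f)
  fix K assume K: "compactin Y K \<and> saturatedin Y K"
  have KY: "K \<subseteq> topspace Y" using K compactin_subset_topspace by blast
  have "{x \<in> topspace X. f x \<in> K} = g ` K"
  proof
    show "{x \<in> topspace X. f x \<in> K} \<subseteq> g ` K"
      using gf by (metis (mono_tags, lifting) image_eqI mem_Collect_eq subsetI)
    show "g ` K \<subseteq> {x \<in> topspace X. f x \<in> K}" using KY fg g by (auto simp: continuous_hom_def)
  qed
  then show "compactin X {x \<in> topspace X. f x \<in> K}"
    using K g image_compactin by (auto simp: continuous_hom_def)
qed

text \<open>The atoms of \<open>powerset_mt X\<close> are the singletons of points, and its open
  sets of atoms are exactly the images of the open sets of \<open>X\<close>, so both mutually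
  inverse maps are continuous.\<close>

lemma singleton_hom:
  "(\<lambda>x\<in>topspace X. {x}) \<in> continuous_hom X (at_space (powerset_mt X))" (is "?t \<in> _")
  and the_elem_hom:
  "(\<lambda>A\<in>atoms (powerset_mt X). the_elem A) \<in> continuous_hom (at_space (powerset_mt X)) X" (is "?s \<in> _")
proof -
  interpret P: spatial_mt "powerset_mt X" by (rule spatial_powerset)
  have openin_iff: "openin (at_space (powerset_mt X)) W \<longleftrightarrow> (\<exists>U. openin X U \<and> W = (\<lambda>x. {x}) ` U)" for W
    unfolding P.openin_at_space mt_opens_powerset
    using openin_subset[of X] eta_powerset[of _ X] by (metis mem_Collect_eq)
  show "?t \<in> continuous_hom X (at_space (powerset_mt X))"
    unfolding continuous_hom_def
  proof (intro CollectI conjI)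
    show "continuous_map X (at_space (powerset_mt X)) ?t"
      unfolding continuous_map_def
    proof (intro conjI allI impI)
      fix W assume "openin (at_space (powerset_mt X)) W"
      then obtain U where U: "openin X U" "W = (\<lambda>x. {x}) ` U" by (auto simp: openin_iff)
      then have "{x \<in> topspace X. ?t x \<in> W} = U" using openin_subset[of X U] by auto
      then show "openin X {x \<in> topspace X. ?t x \<in> W}" using U by metis
    qed (auto simp: P.topspace_at_space atoms_powerset)
  qed (auto simp: P.topspace_at_space atoms_powerset)
  show "?s \<in> continuous_hom (at_space (powerset_mt X)) X"
    unfolding continuous_hom_def
  proof (intro CollectI conjI)
    show "continuous_map (at_space (powerset_mt X)) X ?s"
      unfolding continuous_map_def
    proof (intro conjI allI impI)
      fix U assume U: "openin X U"
      then have "{A \<in> topspace (at_space (powerset_mt X)). ?s A \<in> U} = (\<lambda>x. {x}) ` U"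
        using openin_subset[of X U] by (auto simp: P.topspace_at_space atoms_powerset)
      then show "openin (at_space (powerset_mt X)) {A \<in> topspace (at_space (powerset_mt X)). ?s A \<in> U}"
        using U openin_iff by auto
    qed (auto simp: P.topspace_at_space atoms_powerset)
  qed (auto simp: P.topspace_at_space atoms_powerset)
qed

section \<open>The isomorphism of an atomic algebra with the powerset of its atoms\<close>

context spatial_mt
begin

lemma eta_mt_hom: "(\<lambda>a\<in>carrier M. eta M a) \<in> mt_hom M (powerset_mt (at_space M))"
proof (rule mt_homI)
  let ?e = "\<lambda>a\<in>carrier M. eta M a"
  have sub: "eta M ` S \<subseteq> Pow (topspace (at_space M))" for S
    using eta_subset by (auto simp: topspace_at_space)
  fix S assume S: "S \<subseteq> carrier M"
  have im: "?e ` S = eta M ` S" using S by (intro image_cong) auto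
  show "?e (\<Squnion>S) = \<Squnion>\<^bsub>powerset_mt (at_space M)\<^esub>(?e ` S)"
    unfolding im Sup_powerset[OF sub] using S by (simp add: eta_Sup)
  show "?e (\<Sqinter>S) = \<Sqinter>\<^bsub>powerset_mt (at_space M)\<^esub>(?e ` S)"
    unfolding im Inf_powerset[OF sub] using S by (simp add: eta_Inf topspace_at_space)
next
  fix a assume a: "a \<in> carrier M"
  then show "(\<lambda>a\<in>carrier M. eta M a) (compl M a) =
      compl (powerset_mt (at_space M)) ((\<lambda>a\<in>carrier M. eta M a) a)"
    using eta_subset by (simp add: compl_powerset topspace_at_space eta_compl)
qed (use eta_subset in \<open>auto simp: topspace_at_space eta_Box\<close>)

lemma eta_proper_mt_hom: "(\<lambda>a\<in>carrier M. eta M a) \<in> proper_mt_hom M (powerset_mt (at_space M))"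
proof -
  have "eta M a \<in> mt_KS (powerset_mt (at_space M))" "a \<in> carrier M" if "a \<in> mt_KS M" for a
    using that KS_iff by (auto simp: mt_KS_powerset) (auto simp: mt_KS_def)
  then show ?thesis using eta_mt_hom by (simp add: proper_mt_hom_def)
qed

text \<open>\<open>mt_hom_inverse\<close> reduces this to the law for \<open>Box\<close>, available
  because \<open>eta_Box\<close> is an equality and not only the inequality required of a
  morphism.\<close>

lemma Sup_atoms_mt_hom: "(\<lambda>A\<in>Pow (atoms M). \<Squnion>A) \<in> mt_hom (powerset_mt (at_space M)) M"
proof (rule mt_hom_inverse[OF _ _ eta_mt_hom])
  show "mt M" "mt (powerset_mt (at_space M))"
    using mt_algebra mt_algebra_powerset by (simp_all add: mt_iff)
  show "(\<lambda>A\<in>Pow (atoms M). \<Squnion>A) \<in> carrier (powerset_mt (at_space M)) \<rightarrow>\<^sub>E carrier M"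
    using atoms_carrier by (auto simp: topspace_at_space intro!: sup_closed)
  show "(\<lambda>A\<in>Pow (atoms M). \<Squnion>A) ((\<lambda>a\<in>carrier M. eta M a) a) = a" if "a \<in> carrier M" for a
    using that eta_subset by (simp add: Sup_eta)
  fix A assume "A \<in> carrier (powerset_mt (at_space M))"
  then have A: "A \<subseteq> atoms M" by (simp add: topspace_at_space)
  then have AM: "\<Squnion>A \<in> carrier M" using atoms_carrier by auto
  then show "(\<lambda>a\<in>carrier M. eta M a) ((\<lambda>A\<in>Pow (atoms M). \<Squnion>A) A) = A"
    using A by (simp add: eta_Sup_atoms)
  have "at_space M interior_of A = eta M (Box M (\<Squnion>A))" using A AM by (simp add: eta_Box eta_Sup_atoms)
  then show "(\<lambda>A\<in>Pow (atoms M). \<Squnion>A) (Box (powerset_mt (at_space M)) A) \<sqsubseteq>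
      Box M ((\<lambda>A\<in>Pow (atoms M). \<Squnion>A) A)"
    using A AM eta_subset by (simp add: Sup_eta)
qed

lemma Sup_atoms_proper_mt_hom:
  "(\<lambda>A\<in>Pow (atoms M). \<Squnion>A) \<in> proper_mt_hom (powerset_mt (at_space M)) M"
proof -
  have "(\<lambda>A\<in>Pow (atoms M). \<Squnion>A) K \<in> mt_KS M" if "K \<in> mt_KS (powerset_mt (at_space M))" for K
  proof -
    have K: "compactin (at_space M) K" "saturatedin (at_space M) K"
      using that by (auto simp: mt_KS_powerset)
    then have "K \<subseteq> atoms M" using compactin_subset_topspace topspace_at_space by blast
    then show ?thesis using K KS_iff[of "\<Squnion>K"] atoms_carrier by (auto simp: eta_Sup_atoms)
  qed
  then show ?thesis using Sup_atoms_mt_hom by (simp add: proper_mt_hom_def)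
qed

end

section \<open>The categories and the functor laws\<close>

lemma LKHMT_simps [simp]:
  "Ob LKHMT = {M. mt_algebra M \<and> mt_locally_compact M \<and> mt_Hausdorff M}"
  "Pt LKHMT = carrier" "Hom LKHMT = proper_mt_hom"
  by (simp_all add: LKHMT_def)

lemma LKHaus_simps [simp]:
  "Ob LKHaus = {X. locally_compact_space X \<and> Hausdorff_space X}"
  "Pt LKHaus = topspace" "Hom LKHaus = proper_hom"
  by (simp_all add: LKHaus_def)

lemma KHMT_simps [simp]:
  "Ob KHMT = {M. mt_algebra M \<and> mt_compact M \<and> mt_Hausdorff M}"
  "Pt KHMT = carrier" "Hom KHMT = mt_hom"
  by (simp_all add: KHMT_def)

lemma KHaus_simps [simp]:
  "Ob KHaus = {X. compact_space X \<and> Hausdorff_space X}"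
  "Pt KHaus = topspace" "Hom KHaus = continuous_hom"
  by (simp_all add: KHaus_def)

lemma LKHMT_spatial: "M \<in> Ob LKHMT \<Longrightarrow> spatial_mt M"
  using locally_compact_Hausdorff_spatial by auto

lemma LKHMT_mt: "M \<in> Ob LKHMT \<Longrightarrow> mt M"
  by (simp add: mt_iff)

lemma at_space_Ob: "M \<in> Ob LKHMT \<Longrightarrow> at_space M \<in> Ob LKHaus"
  using LKHMT_spatial spatial_mt.Hausdorff_at_space spatial_mt.locally_compact_at_space by auto

lemma powerset_mt_Ob: "X \<in> Ob LKHaus \<Longrightarrow> powerset_mt X \<in> Ob LKHMT"
  using mt_algebra_powerset mt_locally_compact_powerset mt_Hausdorff_powerset by auto

lemma is_category_LKHMT: "is_category LKHMT"
  unfolding is_category_def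
proof (intro conjI ballI)
  fix M :: "'a mt" assume M: "M \<in> Ob LKHMT"
  have "(\<lambda>a\<in>carrier M. a) \<in> mt_hom M M" using mt_hom_id LKHMT_mt M by blast
  then show "Idn LKHMT M \<in> Hom LKHMT M M" by (auto simp: Idn_def proper_mt_hom_def mt_KS_def)
  fix N :: "'a mt" assume N: "N \<in> Ob LKHMT"
  show "Hom LKHMT M N \<subseteq> Pt LKHMT M \<rightarrow>\<^sub>E Pt LKHMT N"
    by (auto simp: proper_mt_hom_def mt_hom_def)
  fix L :: "'a mt" and f g
  assume L: "L \<in> Ob LKHMT" and f: "f \<in> Hom LKHMT M N" and g: "g \<in> Hom LKHMT N L"
  have "compose (carrier M) g f \<in> mt_hom M L"
    using f g by (intro mt_hom_compose[OF LKHMT_mt[OF M] LKHMT_mt[OF N] LKHMT_mt[OF L]])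
      (auto simp: proper_mt_hom_def)
  then show "compose (Pt LKHMT M) g f \<in> Hom LKHMT M L"
    using f g by (auto simp: proper_mt_hom_def compose_def mt_KS_def)
qed

lemma is_category_LKHaus: "is_category LKHaus"
  unfolding is_category_def
proof (intro conjI ballI)
  fix X :: "'a topology" assume X: "X \<in> Ob LKHaus"
  have "continuous_map X X (\<lambda>x\<in>topspace X. x)"
    by (rule continuous_map_eq[OF continuous_map_id]) auto
  then have id: "(\<lambda>x\<in>topspace X. x) \<in> continuous_hom X X" by (simp add: continuous_hom_def)
  show "Idn LKHaus X \<in> Hom LKHaus X X"
    unfolding Idn_def LKHaus_simps by (rule inverse_proper_hom[OF id id]) auto
  fix Y :: "'a topology" assume Y: "Y \<in> Ob LKHaus"
  show "Hom LKHaus X Y \<subseteq> Pt LKHaus X \<rightarrow>\<^sub>E Pt LKHaus Y"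
    by (auto simp: proper_hom_def continuous_hom_def)
  fix Z :: "'a topology" and f g
  assume Z: "Z \<in> Ob LKHaus" and "f \<in> Hom LKHaus X Y" "g \<in> Hom LKHaus Y Z"
  then have f: "f \<in> proper_hom X Y" and g: "g \<in> proper_hom Y Z" by auto
  have fY: "f x \<in> topspace Y" if "x \<in> topspace X" for x
    using f that by (auto simp: proper_hom_def continuous_hom_def)
  have "continuous_map X Z (compose (topspace X) g f)"
    using f g by (intro continuous_map_eq[OF continuous_map_compose[of X Y f Z g]])
      (auto simp: proper_hom_def continuous_hom_def compose_def)
  moreover have "compose (topspace X) g f \<in> topspace X \<rightarrow>\<^sub>E topspace Z"
    using f g by (auto simp: proper_hom_def continuous_hom_def compose_def)
  moreover have "compactin X {x \<in> topspace X. compose (topspace X) g f x \<in> K}"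
    if "compactin Z K" "saturatedin Z K" for K
  proof -
    \<comment> \<open>Properness of \<open>f\<close> applies only to compact saturated sets, so
      \<open>?L\<close> must be shown saturated as well as compact.\<close>
    let ?L = "{y \<in> topspace Y. g y \<in> K}"
    have "compactin Y ?L" "saturatedin Y ?L"
      using g that saturatedin_preimage by (auto simp: proper_hom_def continuous_hom_def)
    then have "compactin X {x \<in> topspace X. f x \<in> ?L}" using f by (auto simp: proper_hom_def)
    moreover have "{x \<in> topspace X. f x \<in> ?L} = {x \<in> topspace X. compose (topspace X) g f x \<in> K}"
      using fY by (auto simp: compose_def)
    ultimately show ?thesis by simp
  qed
  ultimately show "compose (Pt LKHaus X) g f \<in> Hom LKHaus X Z"
    by (simp add: proper_hom_def continuous_hom_def)
qed

lemma at_functor_simps [simp]: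
  "on_ob at_functor = at_space"
  "on_hom at_functor M N f = (\<lambda>x\<in>atoms N. left_adj M N f x)"
  by (simp_all add: at_functor_def)

lemma powerset_functor_simps [simp]:
  "on_ob powerset_functor = powerset_mt"
  "on_hom powerset_functor X Y f = (\<lambda>B\<in>Pow (topspace Y). {x \<in> topspace X. f x \<in> B})"
  by (simp_all add: powerset_functor_def)

lemma contravariant_functor_at: "contravariant_functor LKHMT LKHaus at_functor"
  unfolding contravariant_functor_def
proof (intro conjI ballI)
  fix M :: "'a mt" assume M: "M \<in> Ob LKHMT"
  show "on_ob at_functor M \<in> Ob LKHaus" using at_space_Ob[OF M] by simp
  interpret M: spatial_mt M using M by (rule LKHMT_spatial)
  interpret id: mt_morphism M M "\<lambda>a\<in>carrier M. a"
    using mt_hom_id[OF LKHMT_mt[OF M]] by unfold_locales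
  have "left_adj M M (\<lambda>a\<in>carrier M. a) x = x" if "x \<in> atoms M" for x
    using id.left_adj_closed M.atoms_closed[OF that] id.left_adj_le_iff by (intro M.le_unique) auto
  then show "on_hom at_functor M M (Idn LKHMT M) = Idn LKHaus (on_ob at_functor M)"
    by (auto simp: Idn_def M.topspace_at_space)
  fix N :: "'a mt" and f assume N: "N \<in> Ob LKHMT" and f: "f \<in> Hom LKHMT M N"
  interpret N: spatial_mt N using N by (rule LKHMT_spatial)
  interpret f: mt_morphism M N f using f by unfold_locales (simp add: proper_mt_hom_def)
  have "f.at_map \<in> proper_hom (at_space N) (at_space M)"
    using f by (intro f.at_map_proper_hom) (auto intro: M.spatial_mt_axioms N.spatial_mt_axioms)
  then show "on_hom at_functor M N f \<in> Hom LKHaus (on_ob at_functor N) (on_ob at_functor M)"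
    by (simp add: f.at_map_def)
  fix L :: "'a mt" and g assume L: "L \<in> Ob LKHMT" and g: "g \<in> Hom LKHMT N L"
  interpret L: spatial_mt L using L by (rule LKHMT_spatial)
  interpret g: mt_morphism N L g using g by unfold_locales (simp add: proper_mt_hom_def)
  interpret gf: mt_morphism M L "compose (carrier M) g f"
    using mt_hom_compose[OF _ _ _ f.hom g.hom] M.mt_axioms N.mt_axioms L.mt_axioms by unfold_locales
  \<comment> \<open>Left adjoints compose in reverse order: by the three adjunctions both sides are
    below \<open>a\<close> exactly when \<open>x\<close> is below \<open>g (f a)\<close>.\<close>
  have "left_adj M L (compose (carrier M) g f) x = left_adj M N f (left_adj N L g x)" if "x \<in> atoms L" for x
    using gf.left_adj_closed f.left_adj_closed g.left_adj_closed L.atoms_closed[OF that]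
    by (intro M.le_unique)
      (simp_all add: gf.left_adj_le_iff f.left_adj_le_iff g.left_adj_le_iff compose_eq f.hom_closed)
  then show "on_hom at_functor M L (compose (Pt LKHMT M) g f) =
      compose (Pt LKHaus (on_ob at_functor L)) (on_hom at_functor M N f) (on_hom at_functor N L g)"
    using g.left_adj_atom by (auto simp: compose_def L.topspace_at_space restrict_def)
qed

lemma contravariant_functor_powerset: "contravariant_functor LKHaus LKHMT powerset_functor"
  unfolding contravariant_functor_def
proof (intro conjI ballI)
  fix X :: "'a topology" assume X: "X \<in> Ob LKHaus"
  show "on_ob powerset_functor X \<in> Ob LKHMT" using powerset_mt_Ob[OF X] by simp
  show "on_hom powerset_functor X X (Idn LKHaus X) = Idn LKHMT (on_ob powerset_functor X)"
    by (auto simp: Idn_def restrict_def fun_eq_iff)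
  fix Y :: "'a topology" and f assume Y: "Y \<in> Ob LKHaus" and f: "f \<in> Hom LKHaus X Y"
  then show "on_hom powerset_functor X Y f \<in>
      Hom LKHMT (on_ob powerset_functor Y) (on_ob powerset_functor X)"
    using powerset_functor_proper_mt_hom[of f X Y] by simp
  fix Z :: "'a topology" and g assume Z: "Z \<in> Ob LKHaus" and g: "g \<in> Hom LKHaus Y Z"
  have "f x \<in> topspace Y" if "x \<in> topspace X" for x
    using f that by (auto simp: proper_hom_def continuous_hom_def)
  then show "on_hom powerset_functor X Z (compose (Pt LKHaus X) g f) =
      compose (Pt LKHMT (on_ob powerset_functor Z)) (on_hom powerset_functor X Y f)
        (on_hom powerset_functor Y Z g)"
    by (auto simp: compose_def restrict_def fun_eq_iff)
qed

section \<open>The natural isomorphisms of the duality\<close>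

lemma id_functor_simps [simp]: "on_ob id_functor X = X" "on_hom id_functor X Y f = f"
  by (simp_all add: id_functor_def)

lemma contra_comp_simps [simp]:
  "on_ob (contra_comp G F) X = on_ob G (on_ob F X)"
  "on_hom (contra_comp G F) X Y f = on_hom G (on_ob F Y) (on_ob F X) (on_hom F X Y f)"
  by (simp_all add: contra_comp_def)

lemma naturally_isomorphic_LKHaus:
  "naturally_isomorphic LKHaus LKHaus id_functor LKHaus (contra_comp at_functor powerset_functor)
    proper_hom proper_hom"
  unfolding naturally_isomorphic_def
proof (intro exI[of _ "\<lambda>X. \<lambda>x\<in>topspace X. {x}"] conjI ballI)
  fix X :: "'a topology" assume X: "X \<in> Ob LKHaus"
  interpret P: spatial_mt "powerset_mt X" by (rule spatial_powerset)
  let ?t = "\<lambda>x\<in>topspace X. {x}" and ?s = "\<lambda>A\<in>atoms (powerset_mt X). the_elem A"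
  have st: "?s (?t x) = x" if "x \<in> topspace X" for x using that by (simp add: atoms_powerset)
  have ts: "?t (?s A) = A" if "A \<in> topspace (at_space (powerset_mt X))" for A
    using that by (auto simp: P.topspace_at_space atoms_powerset)
  have "?t \<in> proper_hom X (at_space (powerset_mt X))"
    using singleton_hom the_elem_hom st ts by (rule inverse_proper_hom)
  then show "?t \<in> proper_hom (on_ob id_functor X) (on_ob (contra_comp at_functor powerset_functor) X)"
    by simp
  have "?s \<in> proper_hom (at_space (powerset_mt X)) X"
    using the_elem_hom singleton_hom ts st by (rule inverse_proper_hom)
  moreover have "compose (topspace X) ?s ?t = (\<lambda>x\<in>topspace X. x)"
    unfolding compose_def using st by (intro restrict_ext)
  moreover have "compose (topspace (at_space (powerset_mt X))) ?t ?s =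
      (\<lambda>A\<in>topspace (at_space (powerset_mt X)). A)"
    unfolding compose_def using ts by (intro restrict_ext)
  ultimately show "\<exists>\<sigma>\<in>proper_hom (on_ob (contra_comp at_functor powerset_functor) X) (on_ob id_functor X).
      compose (Pt LKHaus (on_ob id_functor X)) \<sigma> ?t = Idn LKHaus (on_ob id_functor X) \<and>
      compose (Pt LKHaus (on_ob (contra_comp at_functor powerset_functor) X)) ?t \<sigma> =
        Idn LKHaus (on_ob (contra_comp at_functor powerset_functor) X)"
    unfolding Idn_def by (intro bexI[of _ ?s]) simp_all
  fix Y :: "'a topology" and f assume Y: "Y \<in> Ob LKHaus" and f: "f \<in> Hom LKHaus X Y"
  interpret Q: spatial_mt "powerset_mt Y" by (rule spatial_powerset)
  let ?P = "\<lambda>B\<in>Pow (topspace Y). {x \<in> topspace X. f x \<in> B}"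
  have f': "f \<in> continuous_hom X Y" using f by (simp add: proper_hom_def)
  then have fY: "f x \<in> topspace Y" if "x \<in> topspace X" for x
    using that by (auto simp: continuous_hom_def)
  interpret mt_morphism "powerset_mt Y" "powerset_mt X" ?P
    using powerset_functor_mt_hom[OF f'] by unfold_locales simp
  \<comment> \<open>The left adjoint of the preimage map is the direct image; on singletons this is
    exactly the naturality square.\<close>
  have "left_adj (powerset_mt Y) (powerset_mt X) ?P {x} = {f x}" if "x \<in> topspace X" for x
    using that left_adj_closed fY left_adj_le_iff[of "{x}"] by (intro Q.le_unique) auto
  then show "compose (Pt LKHaus (on_ob id_functor X)) (\<lambda>x\<in>topspace Y. {x}) (on_hom id_functor X Y f) =
      compose (Pt LKHaus (on_ob id_functor X))
        (on_hom (contra_comp at_functor powerset_functor) X Y f) ?t"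
    using fY by (auto simp: compose_def atoms_powerset intro!: restrict_ext)
qed

lemma naturally_isomorphic_LKHMT:
  "naturally_isomorphic LKHMT LKHMT id_functor LKHMT (contra_comp powerset_functor at_functor)
    proper_mt_hom proper_mt_hom"
  unfolding naturally_isomorphic_def
proof (intro exI[of _ "\<lambda>M. \<lambda>a\<in>carrier M. eta M a"] conjI ballI)
  fix M :: "'a mt" assume M: "M \<in> Ob LKHMT"
  interpret M: spatial_mt M using M by (rule LKHMT_spatial)
  let ?t = "\<lambda>a\<in>carrier M. eta M a" and ?s = "\<lambda>A\<in>Pow (atoms M). \<Squnion>\<^bsub>M\<^esub>A"
  show "?t \<in> proper_mt_hom (on_ob id_functor M) (on_ob (contra_comp powerset_functor at_functor) M)"
    using M.eta_proper_mt_hom by simp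
  have "compose (carrier M) ?s ?t = (\<lambda>a\<in>carrier M. a)"
    unfolding compose_def using M.eta_subset by (intro restrict_ext) (simp add: M.Sup_eta)
  moreover have "compose (Pow (atoms M)) ?t ?s = (\<lambda>A\<in>Pow (atoms M). A)"
    unfolding compose_def using M.atoms_carrier
    by (intro restrict_ext) (auto simp: M.eta_Sup_atoms subset_trans)
  ultimately show "\<exists>\<sigma>\<in>proper_mt_hom (on_ob (contra_comp powerset_functor at_functor) M) (on_ob id_functor M).
      compose (Pt LKHMT (on_ob id_functor M)) \<sigma> ?t = Idn LKHMT (on_ob id_functor M) \<and>
      compose (Pt LKHMT (on_ob (contra_comp powerset_functor at_functor) M)) ?t \<sigma> =
        Idn LKHMT (on_ob (contra_comp powerset_functor at_functor) M)"
    unfolding Idn_def using M.Sup_atoms_proper_mt_hom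
    by (intro bexI[of _ ?s]) (simp_all add: M.topspace_at_space)
  fix N :: "'a mt" and f assume N: "N \<in> Ob LKHMT" and f: "f \<in> Hom LKHMT M N"
  interpret N: spatial_mt N using N by (rule LKHMT_spatial)
  interpret mt_morphism M N f using f by unfold_locales (simp add: proper_mt_hom_def)
  \<comment> \<open>Naturality of \<open>eta\<close> is the preimage identity for
    \<open>at_map\<close>, written in the form in which the composite functor unfolds.\<close>
  have "eta N (f a) = {x \<in> topspace (at_space N). (\<lambda>x\<in>atoms N. left_adj M N f x) x \<in> eta M a}"
    if "a \<in> carrier M" for a
    using at_map_eta_preimage[OF that] unfolding at_map_def by simp
  then show "compose (Pt LKHMT (on_ob id_functor M)) (\<lambda>a\<in>carrier N. eta N a) (on_hom id_functor M N f) =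
      compose (Pt LKHMT (on_ob id_functor M))
        (on_hom (contra_comp powerset_functor at_functor) M N f) ?t"
    unfolding compose_def using hom_closed M.eta_subset
    by (simp add: M.topspace_at_space cong: restrict_cong)
qed

section \<open>Restriction to full subcategories\<close>

lemma full_subcategory_is_category:
  assumes "full_subcategory C D" "is_category D"
  shows "is_category C"
  using assms unfolding full_subcategory_def is_category_def Idn_def
  by (simp add: subset_iff) blast

lemma contravariant_functor_restrict:
  assumes "full_subcategory C' C" "full_subcategory D' D" "contravariant_functor C D F"
    and "\<And>X. X \<in> Ob C' \<Longrightarrow> on_ob F X \<in> Ob D'"
  shows "contravariant_functor C' D' F"
  using assms unfolding full_subcategory_def contravariant_functor_def Idn_def
  by (simp add: subset_iff)

text \<open>The same isomorphisms serve on the smaller class of objects. Since \<open>H\<close> and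
  \<open>K\<close> relate objects over different element types, \<open>full_subcategory\<close> says
  nothing about them; their agreement with \<open>H'\<close> and \<open>K'\<close> is assumed at the
  objects that occur.\<close>

lemma naturally_isomorphic_restrict:
  assumes "full_subcategory C' C" "full_subcategory D' D" "full_subcategory E' E"
    and "naturally_isomorphic C D F E G H K"
    and "\<And>X. X \<in> Ob C' \<Longrightarrow> on_ob F X \<in> Ob D'" "\<And>X. X \<in> Ob C' \<Longrightarrow> on_ob G X \<in> Ob E'"
    and "\<And>X. X \<in> Ob C' \<Longrightarrow> H' (on_ob F X) (on_ob G X) = H (on_ob F X) (on_ob G X)"
    and "\<And>X. X \<in> Ob C' \<Longrightarrow> K' (on_ob G X) (on_ob F X) = K (on_ob G X) (on_ob F X)"
  shows "naturally_isomorphic C' D' F E' G H' K'"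
proof -
  have [simp]: "X \<in> Ob C" "Pt D' (on_ob F X) = Pt D (on_ob F X)" "Pt E' (on_ob G X) = Pt E (on_ob G X)"
    if "X \<in> Ob C'" for X
    using assms(1-3,5,6) that by (auto simp: full_subcategory_def)
  have [simp]: "Hom C' X Y = Hom C X Y" if "X \<in> Ob C'" "Y \<in> Ob C'" for X Y
    using assms(1) that by (simp add: full_subcategory_def)
  show ?thesis
    using assms(4) unfolding naturally_isomorphic_def Idn_def
    by (elim ex_forward) (simp add: assms(7,8))
qed

text \<open>Inclusion of objects is the passage from compact to locally compact through the space of
  atoms; equality of hom-sets is automatic properness.\<close>

lemma full_subcategory_KHMT: "full_subcategory KHMT LKHMT"
  unfolding full_subcategory_def
  using spatial_mt.compact_Hausdorff_imp_locally_compact compact_Hausdorff_spatial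
  by (auto simp: proper_mt_hom_compact_Hausdorff)

lemma full_subcategory_KHaus: "full_subcategory KHaus LKHaus"
  unfolding full_subcategory_def
  using compact_imp_locally_compact_space by (auto simp: proper_hom_compact_Hausdorff)

lemma at_space_Ob_KHaus: "M \<in> Ob KHMT \<Longrightarrow> at_space M \<in> Ob KHaus"
  using compact_Hausdorff_spatial spatial_mt.Hausdorff_at_space spatial_mt.mt_compact_iff by auto

lemma powerset_mt_Ob_KHMT: "X \<in> Ob KHaus \<Longrightarrow> powerset_mt X \<in> Ob KHMT"
  using mt_algebra_powerset mt_compact_powerset mt_Hausdorff_powerset by auto

text \<open>A compact Hausdorff space and its double dual are both compact Hausdorff, so automatic
  properness also identifies the hom-sets across the two element types.\<close>

lemma naturally_isomorphic_KHaus: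
  "naturally_isomorphic KHaus KHaus id_functor KHaus (contra_comp at_functor powerset_functor)
    continuous_hom continuous_hom"
proof (rule naturally_isomorphic_restrict[OF full_subcategory_KHaus full_subcategory_KHaus
      full_subcategory_KHaus naturally_isomorphic_LKHaus])
  fix X :: "'a topology" assume X: "X \<in> Ob KHaus"
  then have "at_space (powerset_mt X) \<in> Ob KHaus" using at_space_Ob_KHaus powerset_mt_Ob_KHMT by blast
  with X show "on_ob id_functor X \<in> Ob KHaus"
    "on_ob (contra_comp at_functor powerset_functor) X \<in> Ob KHaus"
    "continuous_hom (on_ob id_functor X) (on_ob (contra_comp at_functor powerset_functor) X) =
      proper_hom (on_ob id_functor X) (on_ob (contra_comp at_functor powerset_functor) X)"
    "continuous_hom (on_ob (contra_comp at_functor powerset_functor) X) (on_ob id_functor X) =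
      proper_hom (on_ob (contra_comp at_functor powerset_functor) X) (on_ob id_functor X)"
    by (simp_all add: proper_hom_compact_Hausdorff)
qed

lemma naturally_isomorphic_KHMT:
  "naturally_isomorphic KHMT KHMT id_functor KHMT (contra_comp powerset_functor at_functor)
    mt_hom mt_hom"
proof (rule naturally_isomorphic_restrict[OF full_subcategory_KHMT full_subcategory_KHMT
      full_subcategory_KHMT naturally_isomorphic_LKHMT])
  fix M :: "'a mt" assume M: "M \<in> Ob KHMT"
  then have "powerset_mt (at_space M) \<in> Ob KHMT" using at_space_Ob_KHaus powerset_mt_Ob_KHMT by blast
  with M show "on_ob id_functor M \<in> Ob KHMT"
    "on_ob (contra_comp powerset_functor at_functor) M \<in> Ob KHMT"
    "mt_hom (on_ob id_functor M) (on_ob (contra_comp powerset_functor at_functor) M) =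
      proper_mt_hom (on_ob id_functor M) (on_ob (contra_comp powerset_functor at_functor) M)"
    "mt_hom (on_ob (contra_comp powerset_functor at_functor) M) (on_ob id_functor M) =
      proper_mt_hom (on_ob (contra_comp powerset_functor at_functor) M) (on_ob id_functor M)"
    by (simp_all add: proper_mt_hom_compact_Hausdorff)
qed

theorem theorem6p16:
  shows
    "(is_category (LKHMT :: ('b mt, 'b) concrete_category) \<and>
      is_category (LKHaus :: ('a topology, 'a) concrete_category) \<and>
      contravariant_functor (LKHMT :: ('b mt, 'b) concrete_category) LKHaus at_functor \<and>
      contravariant_functor (LKHaus :: ('a topology, 'a) concrete_category) LKHMT powerset_functor \<and>
      naturally_isomorphic (LKHaus :: ('a topology, 'a) concrete_category)
        LKHaus id_functor LKHaus (contra_comp at_functor powerset_functor) proper_hom proper_hom \<and>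
      naturally_isomorphic (LKHMT :: ('b mt, 'b) concrete_category)
        LKHMT id_functor LKHMT (contra_comp powerset_functor at_functor) proper_mt_hom proper_mt_hom)
     \<and>
     (full_subcategory (KHMT :: ('b mt, 'b) concrete_category) LKHMT \<and>
      full_subcategory (KHaus :: ('a topology, 'a) concrete_category) LKHaus)
     \<and>
     (is_category (KHMT :: ('b mt, 'b) concrete_category) \<and>
      is_category (KHaus :: ('a topology, 'a) concrete_category) \<and>
      contravariant_functor (KHMT :: ('b mt, 'b) concrete_category) KHaus at_functor \<and>
      contravariant_functor (KHaus :: ('a topology, 'a) concrete_category) KHMT powerset_functor \<and>
      naturally_isomorphic (KHaus :: ('a topology, 'a) concrete_category)
        KHaus id_functor KHaus (contra_comp at_functor powerset_functor) continuous_hom continuous_hom \<and>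
      naturally_isomorphic (KHMT :: ('b mt, 'b) concrete_category)
        KHMT id_functor KHMT (contra_comp powerset_functor at_functor) mt_hom mt_hom)"
proof -
  have "contravariant_functor (KHMT :: ('b mt, 'b) concrete_category) KHaus at_functor"
    using full_subcategory_KHMT full_subcategory_KHaus contravariant_functor_at
    \<comment> \<open>The rules unfolding \<open>Ob\<close> are removed so that the membership goal
      keeps the form of \<open>at_space_Ob_KHaus\<close>.\<close>
    by (rule contravariant_functor_restrict) (simp add: at_space_Ob_KHaus del: KHMT_simps KHaus_simps)
  moreover have "contravariant_functor (KHaus :: ('a topology, 'a) concrete_category) KHMT powerset_functor"
    using full_subcategory_KHaus full_subcategory_KHMT contravariant_functor_powerset
    by (rule contravariant_functor_restrict) (simp add: powerset_mt_Ob_KHMT del: KHMT_simps KHaus_simps)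
  moreover have "is_category (KHMT :: ('b mt, 'b) concrete_category)"
    using full_subcategory_KHMT is_category_LKHMT by (rule full_subcategory_is_category)
  moreover have "is_category (KHaus :: ('a topology, 'a) concrete_category)"
    using full_subcategory_KHaus is_category_LKHaus by (rule full_subcategory_is_category)
  ultimately show ?thesis
    by (intro conjI is_category_LKHMT is_category_LKHaus contravariant_functor_at
        contravariant_functor_powerset naturally_isomorphic_LKHaus naturally_isomorphic_LKHMT
        full_subcategory_KHMT full_subcategory_KHaus naturally_isomorphic_KHaus naturally_isomorphic_KHMT)
qed

end
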